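(* Assume the following (Assumption 2): $\inf_{(x,u)\in\mathbb{K},\,r\in\mathscr{R}_c} f^{\gamma}(r\mid x,u)>0$ and $\inf_{(x,u)\in\mathbb{K},\,y\in\mathcal{X}} q^{\gamma}(y\mid x,u)>0$ for every $\gamma\in\mathcal{P}$, and $\inf_{(x,u)\in\mathbb{K}}\mathcal{K}(\rho^{\theta}_{x,u}\mid\rho^{\gamma}_{x,u})>0$ for every $\gamma\in\mathcal{P}$ with $\gamma\neq\theta$. Let $M\ge 0$ be a constant with $|r^\theta(x,u)|\le M$ for all $(x,u)\in\mathbb{K}$. Then the expected residual regret of Thompson sampling converges to $0$ exponentially fast: for every initial state $x_0\in\mathcal{X}$ there exist constants $a_\theta,b_\theta>0$ satisfying $\mathbb{E}^{\tau,\theta}_{x_0}[1-\pi_t(\theta\mid H_t)]\le a_\theta e^{-b_\theta t}$ for all $t\ge 0$, and for these constants, for all $n\ge 0$, $$\mathcal{R}^{\tau,\theta}_{x_0}(n)=\mathbb{E}^{\tau,\theta}_{x_0}[\nu^\theta(X_n)]-V^{\tau,\theta}_{x_0}(n)\;\le\;\frac{2M(1+\beta)a_\theta e^{-b_\theta n}}{(1-\beta)^2}.$$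
   Context: Model. $\mathcal{X}$ (states) and $\mathcal{U}$ (controls) are Borel spaces; for each $x\in\mathcal{X}$, $\mathcal{U}(x)\subseteq\mathcal{U}$ is the compact set of admissible controls, $\mathcal{U}=\bigcup_x\mathcal{U}(x)$, and $\mathbb{K}=\{(x,u):x\in\mathcal{X},u\in\mathcal{U}(x)\}$ is measurable in $\mathcal{X}\times\mathcal{U}$. $\mathcal{P}$ is a finite parameter set; $\theta\in\mathcal{P}$ is the fixed true parameter, unknown to the decision-maker. $\mathscr{R}_c\subset\mathbb{R}_+$ is a compact measurable set of rewards. For each $\gamma\in\mathcal{P}$ and $(x,u)\in\mathbb{K}$, $f^\gamma(\cdot\mid x,u)$ is a measurable, continuous (in $r$) probability density on $\mathscr{R}_c$ with respect to a $\sigma$-finite measure $\lambda$, and $q^\gamma(\cdot\mid x,u)$ is a probability density on $\mathcal{X}$ with respect to a $\sigma$-finite measure $\eta$; $Q^\gamma(dy\mid x,u)=q^\gamma(y\mid x,u)\,d\eta(y)$ is the transition law and $r^\gamma(x,u)=\int_{\mathscr{R}_c} r f^\gamma(r\mid x,u)\,d\lambda(r)$ is the expected reward. $\beta\in[0,1)$ is the discount factor. Standing Assumption 1. For every $\gamma\in\mathcal{P}$ the equation $\nu^\gamma(x)=\sup_{u\in\mathcal{U}(x)}\{r^\gamma(x,u)+\beta\int\nu^\gamma(y)Q^\gamma(dy\mid x,u)\}$, $x\in\mathcal{X}$, has a unique solution $\nu^\gamma$, the supremum is attained, and there is a stationary deterministic Markov optimal policy $\mu^\gamma:\mathcal{X}\to\mathcal{U}$,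 $\mu^\gamma(x)\in\mathcal{U}(x)$, attaining it. Moreover $\nu^\gamma(x_0)$ is the supremum, over all admissible randomized history-dependent policies, of the expected total discounted reward $\mathbb{E}[\sum_{t\ge0}\beta^tR_t]$ started from $x_0$ when the true parameter is $\gamma$, and it is achieved by $\mu^\gamma$. Thompson sampling $\tau$. The history at time $t$ is $H_t=(X_0,\Theta_0,U_0,R_0,\dots,X_{t-1},\Theta_{t-1},U_{t-1},R_{t-1},X_t)$. A prior $\pi_0(\cdot\mid h_0)$ on $\mathcal{P}$, $h_0=x_0$, with $\pi_0(\gamma\mid h_0)>0$ for all $\gamma\in\mathcal{P}$ is given. The posterior is $$\pi_t(\gamma\mid H_t)=\frac{\mathcal{L}^\gamma_t(H_t)\pi_0(\gamma\mid h_0)}{\sum_{\gamma'\in\mathcal{P}}\mathcal{L}^{\gamma'}_t(H_t)\pi_0(\gamma'\mid h_0)},\qquad \mathcal{L}^\gamma_t(H_t)=\prod_{s=1}^t f^\gamma(R_{s-1}\mid X_{s-1},U_{s-1})\,q^\gamma(X_s\mid X_{s-1},U_{s-1}).$$ $\mathbb{P}^{\tau,\theta}_{x_0}$ (expectation $\mathbb{E}^{\tau,\theta}_{x_0}$) is the unique probability measure on the space of infinite sequences $(X_0,\Theta_0,U_0,R_0,X_1,\dots)$ such that $X_0=x_0$ a.s. and, for each $t\ge0$: given $H_t$, $\Theta_t$ has law $\pi_t(\cdot\mid H_t)$; $U_t=\mu^{\Theta_t}(X_t)$; given $(H_t,\Theta_t,U_t)$, $R_t$ has density $f^\theta(\cdot\mid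 X_t,U_t)$; given $(H_t,\Theta_t,U_t,R_t)$, $X_{t+1}$ has density $q^\theta(\cdot\mid X_t,U_t)$. $V^{\tau,\theta}_{x_0}(n)=\mathbb{E}^{\tau,\theta}_{x_0}[\sum_{t=n}^\infty\beta^{t-n}R_t]$. Relative entropy. $\rho^\gamma_{x,u}$ is the probability measure on $\mathscr{R}_c\times\mathcal{X}$ with density $f^\gamma(r\mid x,u)q^\gamma(y\mid x,u)$ with respect to $\lambda\otimes\eta$, and $\mathcal{K}(\rho^\theta_{x,u}\mid\rho^\gamma_{x,u})=\int\log\big(d\rho^\theta_{x,u}/d\rho^\gamma_{x,u}\big)\,d\rho^\theta_{x,u}$. *)

theory Defs
  imports "HOL-Probability.Probability"
begin

section \<open>The controlled model\<close>

text \<open>States and controls are Borel spaces, rendered as Borel subsets of Polish spaces and carrying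
  the trace of the Borel \<open>\<sigma>\<close>-algebra. The densities \<open>f\<^sup>\<gamma>(r | x, u)\<close> and \<open>q\<^sup>\<gamma>(y | x, u)\<close> are
  \<open>rew_dens \<gamma> x u r\<close> and \<open>trans_dens \<gamma> x u y\<close>, taken with respect to the reference measures \<open>\<lambda>\<close>
  (\<open>rew_ref\<close>) and \<open>\<eta>\<close> (\<open>state_ref\<close>). Outside the measurable set of admissible pairs they are
  extended to an arbitrary jointly measurable function (for instance by 0).\<close>

record ('x, 'u, 'p) model =
  states :: "'x set"
  adm :: "'x \<Rightarrow> 'u set"
  params :: "'p set"
  rewards :: "real set"
  rew_ref :: "real measure"
  state_ref :: "'x measure"
  rew_dens :: "'p \<Rightarrow> 'x \<Rightarrow> 'u \<Rightarrow> real \<Rightarrow> real"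
  trans_dens :: "'p \<Rightarrow> 'x \<Rightarrow> 'u \<Rightarrow> 'x \<Rightarrow> real"
  disc :: real

definition controls :: "('x, 'u, 'p) model \<Rightarrow> 'u set" where
  "controls M = (\<Union>x\<in>states M. adm M x)"

definition adm_pairs :: "('x, 'u, 'p) model \<Rightarrow> ('x \<times> 'u) set" where
  "adm_pairs M = {(x, u). x \<in> states M \<and> u \<in> adm M x}"

definition state_space :: "('x::polish_space, 'u, 'p) model \<Rightarrow> 'x measure" where
  "state_space M = restrict_space borel (states M)"

definition control_space :: "('x, 'u::polish_space, 'p) model \<Rightarrow> 'u measure" where
  "control_space M = restrict_space borel (controls M)"

definition reward_space :: "('x, 'u, 'p) model \<Rightarrow> real measure" where
  "reward_space M = restrict_space borel (rewards M)"

definition valid_model :: "('x::polish_space, 'u::polish_space, 'p) model \<Rightarrow> bool" where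
  "valid_model M \<longleftrightarrow>
     states M \<in> sets borel \<and> controls M \<in> sets borel \<and>
     (\<forall>x\<in>states M. compact (adm M x)) \<and>
     adm_pairs M \<in> sets (state_space M \<Otimes>\<^sub>M control_space M) \<and>
     finite (params M) \<and>
     compact (rewards M) \<and> rewards M \<subseteq> {0..} \<and>
     sigma_finite_measure (rew_ref M) \<and> sets (rew_ref M) = sets (reward_space M) \<and>
     sigma_finite_measure (state_ref M) \<and> sets (state_ref M) = sets (state_space M) \<and>
     0 \<le> disc M \<and> disc M < 1 \<and>
     (\<forall>\<gamma>\<in>params M.
        (\<lambda>((x, u), r). rew_dens M \<gamma> x u r) \<in> borel_measurable ((state_space M \<Otimes>\<^sub>M control_space M) \<Otimes>\<^sub>M reward_space M) \<and>
        (\<lambda>((x, u), y). trans_dens M \<gamma> x u y) \<in> borel_measurable ((state_space M \<Otimes>\<^sub>M control_space M) \<Otimes>\<^sub>M state_space M) \<and>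
        (\<forall>(x, u)\<in>adm_pairs M.
           continuous_on (rewards M) (rew_dens M \<gamma> x u) \<and>
           (\<forall>r\<in>rewards M. 0 \<le> rew_dens M \<gamma> x u r) \<and>
           (\<integral>\<^sup>+ r. ennreal (rew_dens M \<gamma> x u r) \<partial>rew_ref M) = 1 \<and>
           (\<forall>y\<in>states M. 0 \<le> trans_dens M \<gamma> x u y) \<and>
           (\<integral>\<^sup>+ y. ennreal (trans_dens M \<gamma> x u y) \<partial>state_ref M) = 1))"

definition reward_law :: "('x, 'u, 'p) model \<Rightarrow> 'p \<Rightarrow> 'x \<Rightarrow> 'u \<Rightarrow> real measure" where
  "reward_law M \<gamma> x u = density (rew_ref M) (\<lambda>r. ennreal (rew_dens M \<gamma> x u r))"

definition trans_law :: "('x, 'u, 'p) model \<Rightarrow> 'p \<Rightarrow> 'x \<Rightarrow> 'u \<Rightarrow> 'x measure" where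
  "trans_law M \<gamma> x u = density (state_ref M) (\<lambda>y. ennreal (trans_dens M \<gamma> x u y))"

definition exp_reward :: "('x, 'u, 'p) model \<Rightarrow> 'p \<Rightarrow> 'x \<Rightarrow> 'u \<Rightarrow> real" where
  "exp_reward M \<gamma> x u = (\<integral>r. r * rew_dens M \<gamma> x u r \<partial>rew_ref M)"

definition joint_law :: "('x, 'u, 'p) model \<Rightarrow> 'p \<Rightarrow> 'x \<Rightarrow> 'u \<Rightarrow> (real \<times> 'x) measure" where
  "joint_law M \<gamma> x u = density (rew_ref M \<Otimes>\<^sub>M state_ref M)
     (\<lambda>(r, y). ennreal (rew_dens M \<gamma> x u r * trans_dens M \<gamma> x u y))"

text \<open>Relative entropy \<open>\<K>(\<rho> | \<sigma>)\<close> with values in the extended reals. The Bochner integral in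
  \<open>KL_divergence\<close> would assign the value 0 to an infinite relative entropy, so the positive and
  negative parts of \<open>log (d\<rho>/d\<sigma>)\<close> are integrated separately (\<open>ennreal\<close> truncates at 0; the
  negative part has finite integral for probability measures). As usual the value is infinite if
  \<open>\<rho>\<close> is not absolutely continuous with respect to \<open>\<sigma>\<close>.\<close>

definition rel_entropy :: "'a measure \<Rightarrow> 'a measure \<Rightarrow> ereal" where
  "rel_entropy \<rho> \<sigma> =
     (if absolutely_continuous \<sigma> \<rho>
      then enn2ereal (\<integral>\<^sup>+ z. ennreal (entropy_density (exp 1) \<sigma> \<rho> z) \<partial>\<rho>)
         - enn2ereal (\<integral>\<^sup>+ z. ennreal (- entropy_density (exp 1) \<sigma> \<rho> z) \<partial>\<rho>)
      else \<infinity>)"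


section \<open>Histories and conditional laws\<close>

text \<open>A trajectory is a sequence of steps whose first component is the state. The history at time
  \<open>t\<close> consists of the steps before \<open>t\<close> and the state at time \<open>t\<close>; thus \<open>snd\<close> of a history is the
  current state.\<close>

type_synonym ('x, 's) history = "(nat \<Rightarrow> 'x \<times> 's) \<times> 'x"

definition hist :: "nat \<Rightarrow> (nat \<Rightarrow> 'x \<times> 's) \<Rightarrow> ('x, 's) history" where
  "hist t \<omega> = (restrict \<omega> {..<t}, fst (\<omega> t))"

definition hist_space ::
  "('x::polish_space, 'u, 'p) model \<Rightarrow> ('x \<times> 's) measure \<Rightarrow> nat \<Rightarrow> ('x, 's) history measure" where
  "hist_space M S t = (\<Pi>\<^sub>M i\<in>{..<t}. S) \<Otimes>\<^sub>M state_space M"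

text \<open>Given \<open>Z\<close> (with values in \<open>S\<close>), the random variable \<open>Y\<close> (with values in \<open>T\<close>) has
  conditional law \<open>\<kappa> Z\<close>.\<close>

definition cond_law ::
  "'w measure \<Rightarrow> ('w \<Rightarrow> 'z) \<Rightarrow> 'z measure \<Rightarrow> ('w \<Rightarrow> 'y) \<Rightarrow> 'y measure \<Rightarrow> ('z \<Rightarrow> 'y measure) \<Rightarrow> bool"
  where
  "cond_law P Z S Y T \<kappa> \<longleftrightarrow>
     (\<forall>A\<in>sets S. \<forall>B\<in>sets T.
        emeasure P {\<omega> \<in> space P. Z \<omega> \<in> A \<and> Y \<omega> \<in> B}
        = (\<integral>\<^sup>+ \<omega>. indicator A (Z \<omega>) * emeasure (\<kappa> (Z \<omega>)) B \<partial>P))"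


section \<open>Policies and optimality\<close>

type_synonym ('x, 'u) step = "'x \<times> 'u \<times> real"
type_synonym ('x, 'u) policy = "nat \<Rightarrow> ('x, 'u \<times> real) history \<Rightarrow> 'u measure"

definition step_space :: "('x::polish_space, 'u::polish_space, 'p) model \<Rightarrow> ('x, 'u) step measure" where
  "step_space M = state_space M \<Otimes>\<^sub>M (control_space M \<Otimes>\<^sub>M reward_space M)"

text \<open>Randomized history-dependent policies.\<close>

definition admissible_policy ::
  "('x::polish_space, 'u::polish_space, 'p) model \<Rightarrow> ('x, 'u) policy \<Rightarrow> bool" where
  "admissible_policy M pol \<longleftrightarrow>
     (\<forall>t. pol t \<in> hist_space M (step_space M) t \<rightarrow>\<^sub>M prob_algebra (control_space M) \<and>
          (\<forall>h\<in>space (hist_space M (step_space M) t). AE u in pol t h. u \<in> adm M (snd h)))"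

definition stationary_policy ::
  "('x, 'u::polish_space, 'p) model \<Rightarrow> ('x \<Rightarrow> 'u) \<Rightarrow> ('x, 'u) policy" where
  "stationary_policy M m = (\<lambda>t h. return (control_space M) (m (snd h)))"

text \<open>\<open>P\<close> is the law of the trajectory \<open>(X\<^sub>0, U\<^sub>0, R\<^sub>0, X\<^sub>1, \<dots>)\<close> under the policy \<open>pol\<close>, the
  parameter \<open>\<gamma>\<close> and the initial state \<open>x0\<close>.\<close>

definition policy_law ::
  "('x::polish_space, 'u::polish_space, 'p) model \<Rightarrow> ('x, 'u) policy \<Rightarrow> 'p \<Rightarrow> 'x
     \<Rightarrow> (nat \<Rightarrow> ('x, 'u) step) measure \<Rightarrow> bool" where
  "policy_law M pol \<gamma> x0 P \<longleftrightarrow>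
     (let S = step_space M; X = (\<lambda>t \<omega>. fst (\<omega> t)); U = (\<lambda>t \<omega>. fst (snd (\<omega> t)));
          R = (\<lambda>t \<omega>. snd (snd (\<omega> t)))
      in prob_space P \<and> sets P = sets (\<Pi>\<^sub>M t\<in>UNIV. S) \<and>
         (AE \<omega> in P. X 0 \<omega> = x0) \<and>
         (\<forall>t. cond_law P (hist t) (hist_space M S t) (U t) (control_space M) (pol t) \<and>
              cond_law P (\<lambda>\<omega>. (hist t \<omega>, U t \<omega>)) (hist_space M S t \<Otimes>\<^sub>M control_space M)
                (R t) (reward_space M) (\<lambda>(h, u). reward_law M \<gamma> (snd h) u) \<and>
              cond_law P (\<lambda>\<omega>. (hist t \<omega>, U t \<omega>, R t \<omega>))
                (hist_space M S t \<Otimes>\<^sub>M (control_space M \<Otimes>\<^sub>M reward_space M))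
                (X (Suc t)) (state_space M) (\<lambda>(h, u, r). trans_law M \<gamma> (snd h) u)))"

definition total_reward ::
  "('x, 'u, 'p) model \<Rightarrow> (nat \<Rightarrow> ('x, 'u) step) measure \<Rightarrow> real" where
  "total_reward M P = (\<integral>\<omega>. (\<Sum>t. disc M ^ t * snd (snd (\<omega> t))) \<partial>P)"

definition bellman_rhs :: "('x, 'u, 'p) model \<Rightarrow> 'p \<Rightarrow> ('x \<Rightarrow> real) \<Rightarrow> 'x \<Rightarrow> 'u \<Rightarrow> real" where
  "bellman_rhs M \<gamma> v x u = exp_reward M \<gamma> x u + disc M * (\<integral>y. v y \<partial>trans_law M \<gamma> x u)"

text \<open>Solutions of the optimality equation are sought among the bounded measurable functions on the
  state space. Rewards are bounded, so the optimal value function is bounded.\<close>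

definition bellman_solution ::
  "('x::polish_space, 'u, 'p) model \<Rightarrow> 'p \<Rightarrow> ('x \<Rightarrow> real) \<Rightarrow> bool" where
  "bellman_solution M \<gamma> v \<longleftrightarrow>
     v \<in> borel_measurable (state_space M) \<and> bounded (v ` states M) \<and>
     (\<forall>x\<in>states M. v x = (SUP u\<in>adm M x. bellman_rhs M \<gamma> v x u))"

definition optimality_assumption ::
  "('x::polish_space, 'u::polish_space, 'p) model \<Rightarrow> ('p \<Rightarrow> 'x \<Rightarrow> real) \<Rightarrow> ('p \<Rightarrow> 'x \<Rightarrow> 'u) \<Rightarrow> bool"
  where
  "optimality_assumption M \<nu> \<mu> \<longleftrightarrow>
     (\<forall>\<gamma>\<in>params M.
        bellman_solution M \<gamma> (\<nu> \<gamma>) \<and>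
        (\<forall>v. bellman_solution M \<gamma> v \<longrightarrow> (\<forall>x\<in>states M. v x = \<nu> \<gamma> x)) \<and>
        \<mu> \<gamma> \<in> state_space M \<rightarrow>\<^sub>M control_space M \<and>
        (\<forall>x\<in>states M. \<mu> \<gamma> x \<in> adm M x \<and> \<nu> \<gamma> x = bellman_rhs M \<gamma> (\<nu> \<gamma>) x (\<mu> \<gamma> x)) \<and>
        (\<forall>x\<in>states M.
           \<nu> \<gamma> x = (SUP P\<in>{P. \<exists>pol. admissible_policy M pol \<and> policy_law M pol \<gamma> x P}.
                      total_reward M P) \<and>
           (\<forall>P. policy_law M (stationary_policy M (\<mu> \<gamma>)) \<gamma> x P \<longrightarrow> total_reward M P = \<nu> \<gamma> x)))"


section \<open>Thompson sampling\<close>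

type_synonym ('x, 'u, 'p) ts_step = "'x \<times> 'p \<times> 'u \<times> real"

definition ts_step_space ::
  "('x::polish_space, 'u::polish_space, 'p) model \<Rightarrow> ('x, 'u, 'p) ts_step measure" where
  "ts_step_space M =
     state_space M \<Otimes>\<^sub>M (count_space (params M) \<Otimes>\<^sub>M (control_space M \<Otimes>\<^sub>M reward_space M))"

definition ts_state :: "nat \<Rightarrow> (nat \<Rightarrow> ('x, 'u, 'p) ts_step) \<Rightarrow> 'x" where
  "ts_state t \<omega> = fst (\<omega> t)"

definition ts_param :: "nat \<Rightarrow> (nat \<Rightarrow> ('x, 'u, 'p) ts_step) \<Rightarrow> 'p" where
  "ts_param t \<omega> = fst (snd (\<omega> t))"

definition ts_control :: "nat \<Rightarrow> (nat \<Rightarrow> ('x, 'u, 'p) ts_step) \<Rightarrow> 'u" where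
  "ts_control t \<omega> = fst (snd (snd (\<omega> t)))"

definition ts_reward :: "nat \<Rightarrow> (nat \<Rightarrow> ('x, 'u, 'p) ts_step) \<Rightarrow> real" where
  "ts_reward t \<omega> = snd (snd (snd (\<omega> t)))"

definition hist_state :: "nat \<Rightarrow> ('x, 's) history \<Rightarrow> nat \<Rightarrow> 'x" where
  "hist_state t h s = (if s < t then fst (fst h s) else snd h)"

definition likelihood ::
  "('x, 'u, 'p) model \<Rightarrow> 'p \<Rightarrow> nat \<Rightarrow> ('x, 'p \<times> 'u \<times> real) history \<Rightarrow> real" where
  "likelihood M \<gamma> t h =
     (\<Prod>s=1..t. rew_dens M \<gamma> (hist_state t h (s - 1)) (ts_control (s - 1) (fst h)) (ts_reward (s - 1) (fst h))
            * trans_dens M \<gamma> (hist_state t h (s - 1)) (ts_control (s - 1) (fst h)) (hist_state t h s))"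

definition posterior ::
  "('x, 'u, 'p) model \<Rightarrow> ('p \<Rightarrow> real) \<Rightarrow> nat \<Rightarrow> ('x, 'p \<times> 'u \<times> real) history \<Rightarrow> 'p \<Rightarrow> real" where
  "posterior M p0 t h \<gamma> =
     likelihood M \<gamma> t h * p0 \<gamma> / (\<Sum>\<gamma>'\<in>params M. likelihood M \<gamma>' t h * p0 \<gamma>')"

text \<open>\<open>P\<close> is the law of \<open>(X\<^sub>0, \<Theta>\<^sub>0, U\<^sub>0, R\<^sub>0, X\<^sub>1, \<dots>)\<close> under Thompson sampling with prior \<open>p0\<close> and
  optimal policies \<open>\<mu>\<close>, when the true parameter is \<open>\<theta>\<close> and the initial state is \<open>x0\<close>.\<close>

definition thompson_law ::
  "('x::polish_space, 'u::polish_space, 'p) model \<Rightarrow> ('p \<Rightarrow> 'x \<Rightarrow> 'u) \<Rightarrow> ('p \<Rightarrow> real) \<Rightarrow> 'p \<Rightarrow> 'x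
     \<Rightarrow> (nat \<Rightarrow> ('x, 'u, 'p) ts_step) measure \<Rightarrow> bool" where
  "thompson_law M \<mu> p0 \<theta> x0 P \<longleftrightarrow>
     (let S = ts_step_space M; Pa = count_space (params M)
      in prob_space P \<and> sets P = sets (\<Pi>\<^sub>M t\<in>UNIV. S) \<and>
         (AE \<omega> in P. ts_state 0 \<omega> = x0) \<and>
         (\<forall>t. cond_law P (hist t) (hist_space M S t) (ts_param t) Pa
                (\<lambda>h. point_measure (params M) (\<lambda>\<gamma>. ennreal (posterior M p0 t h \<gamma>))) \<and>
              (AE \<omega> in P. ts_control t \<omega> = \<mu> (ts_param t \<omega>) (ts_state t \<omega>)) \<and>
              cond_law P (\<lambda>\<omega>. (hist t \<omega>, ts_param t \<omega>, ts_control t \<omega>))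
                (hist_space M S t \<Otimes>\<^sub>M (Pa \<Otimes>\<^sub>M control_space M))
                (ts_reward t) (reward_space M) (\<lambda>(h, \<gamma>, u). reward_law M \<theta> (snd h) u) \<and>
              cond_law P (\<lambda>\<omega>. (hist t \<omega>, ts_param t \<omega>, ts_control t \<omega>, ts_reward t \<omega>))
                (hist_space M S t \<Otimes>\<^sub>M (Pa \<Otimes>\<^sub>M (control_space M \<Otimes>\<^sub>M reward_space M)))
                (ts_state (Suc t)) (state_space M) (\<lambda>(h, \<gamma>, u, r). trans_law M \<theta> (snd h) u)))"

definition ts_value ::
  "('x, 'u, 'p) model \<Rightarrow> (nat \<Rightarrow> ('x, 'u, 'p) ts_step) measure \<Rightarrow> nat \<Rightarrow> real" where
  "ts_value M P n = (\<integral>\<omega>. (\<Sum>k. disc M ^ k * ts_reward (n + k) \<omega>) \<partial>P)"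

definition residual_regret ::
  "('x, 'u, 'p) model \<Rightarrow> ('x \<Rightarrow> real) \<Rightarrow> (nat \<Rightarrow> ('x, 'u, 'p) ts_step) measure \<Rightarrow> nat \<Rightarrow> real" where
  "residual_regret M v P n = (\<integral>\<omega>. v (ts_state n \<omega>) \<partial>P) - ts_value M P n"

end

theory Submission
  imports Defs
begin

text \<open>Concentration: with \<open>W\<^sub>t = \<surd>(\<L>\<^sup>\<gamma>\<^sub>t / \<L>\<^sup>\<theta>\<^sub>t)\<close> one has
  \<open>E W\<^sub>t\<^sub>+\<^sub>1 = E (W\<^sub>t h(X\<^sub>t, U\<^sub>t))\<close>, where \<open>h \<le> 1\<close> is the Hellinger affinity of the two laws of
  reward and next state, and \<open>h < 1\<close> pointwise since the relative entropy is positive. As only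
  finitely many controls \<open>\<mu>\<^sup>\<gamma>\<^sup>'(y)\<close> can be used in \<open>y\<close>, the affinity is at most \<open>1 - d\<close> for all \<open>y\<close> in
  a set of positive \<open>\<eta>\<close>-measure, and the lower bounds on the densities make this set reachable
  with uniformly positive weight from everywhere. Hence \<open>E W\<^sub>t\<^sub>+\<^sub>2 \<le> \<rho> E W\<^sub>t\<close> with \<open>\<rho> < 1\<close>, and
  \<open>1 - \<pi>\<^sub>t(\<theta>)\<close> is at most a linear combination of the \<open>W\<^sub>t\<close>, \<open>\<gamma> \<noteq> \<theta>\<close>.

  Regret: by the optimality equation the discounted sum telescopes, and step \<open>t\<close> contributes
  nothing if \<open>\<Theta>\<^sub>t = \<theta>\<close> and at most \<open>2 C / (1 - \<beta>)\<close> otherwise, while \<open>\<Theta>\<^sub>t \<noteq> \<theta>\<close> has probability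
  \<open>E (1 - \<pi>\<^sub>t(\<theta>))\<close>.\<close>

section \<open>Conditional laws with densities, relative entropy, Hellinger affinity\<close>

text \<open>\<open>cond_law\<close> only fixes the joint law of \<open>Z\<close> and
  \<open>Y\<close> on rectangles. These generate the product \<sigma>-algebra and are stable under
  intersection, so the joint law is the measure with density \<open>k\<close> with respect to (law
  of \<open>Z\<close>) \<times> \<eta>. Tonelli then turns any nonnegative expectation into an
  iterated integral.\<close>

lemma cond_law_density_nn_integral:
  fixes k g :: "'z \<times> 'y \<Rightarrow> ennreal"
  assumes P: "prob_space P" and Z: "Z \<in> P \<rightarrow>\<^sub>M S" and Y: "Y \<in> P \<rightarrow>\<^sub>M T"
    and \<eta>: "sigma_finite_measure \<eta>" "sets \<eta> = sets T"
    and k: "k \<in> borel_measurable (S \<Otimes>\<^sub>M T)"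
    and law: "cond_law P Z S Y T (\<lambda>z. density \<eta> (\<lambda>y. k (z, y)))"
    and g: "g \<in> borel_measurable (S \<Otimes>\<^sub>M T)"
  shows "(\<integral>\<^sup>+\<omega>. g (Z \<omega>, Y \<omega>) \<partial>P) = (\<integral>\<^sup>+\<omega>. (\<integral>\<^sup>+y. k (Z \<omega>, y) * g (Z \<omega>, y) \<partial>\<eta>) \<partial>P)"
proof -
  interpret prob_space P by fact
  interpret eta: sigma_finite_measure \<eta> by fact
  let ?D = "distr P S Z"
  have sets_eta[measurable_cong]: "sets \<eta> = sets T" by fact
  note [measurable] = Z Y k g
  interpret D: prob_space ?D by (rule prob_space_distr) measurable
  interpret pair_sigma_finite ?D \<eta> ..
  \<comment> \<open>Uniqueness on a generator: the whole space is itself a rectangle and the joint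
    law is finite, so a constant sequence exhausts the space.\<close>
  have *: "distr P (S \<Otimes>\<^sub>M T) (\<lambda>\<omega>. (Z \<omega>, Y \<omega>)) = density (?D \<Otimes>\<^sub>M \<eta>) k" (is "?L = ?R")
  proof (rule measure_eqI_generator_eq[OF Int_stable_pair_measure_generator[of S T],
        where A = "\<lambda>_::nat. space S \<times> space T" and \<Omega> = "space S \<times> space T"])
    show "{a \<times> b |a b. a \<in> sets S \<and> b \<in> sets T} \<subseteq> Pow (space S \<times> space T)"
      by (auto dest: sets.sets_into_space)
    show "sets ?L = sigma_sets (space S \<times> space T) {a \<times> b |a b. a \<in> sets S \<and> b \<in> sets T}"
      by (simp add: sets_pair_measure)
    have "sets (?D \<Otimes>\<^sub>M \<eta>) = sets (S \<Otimes>\<^sub>M T)"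
      by (intro sets_pair_measure_cong) (simp_all add: sets_eta)
    then show "sets ?R = sigma_sets (space S \<times> space T) {a \<times> b |a b. a \<in> sets S \<and> b \<in> sets T}"
      by (simp add: sets_pair_measure)
    show "range (\<lambda>_::nat. space S \<times> space T) \<subseteq> {a \<times> b |a b. a \<in> sets S \<and> b \<in> sets T}" by auto
    show "(\<Union>i::nat. space S \<times> space T) = space S \<times> space T" by auto
    show "emeasure ?L (space S \<times> space T) \<noteq> \<infinity>"
      by (subst emeasure_distr) (auto simp: less_top[symmetric])
    fix X assume "X \<in> {a \<times> b |a b. a \<in> sets S \<and> b \<in> sets T}"
    then obtain A B where X: "X = A \<times> B" and [measurable]: "A \<in> sets S" "B \<in> sets T" by auto
    have "emeasure ?L X = emeasure P {\<omega> \<in> space P. Z \<omega> \<in> A \<and> Y \<omega> \<in> B}"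
      unfolding X by (subst emeasure_distr) (auto intro!: arg_cong[where f = "emeasure P"])
    also have "\<dots> = (\<integral>\<^sup>+ \<omega>. indicator A (Z \<omega>) * emeasure (density \<eta> (\<lambda>y. k (Z \<omega>, y))) B \<partial>P)"
      using law by (simp add: cond_law_def)
    also have "\<dots> = (\<integral>\<^sup>+ \<omega>. (\<integral>\<^sup>+y. k (Z \<omega>, y) * indicator (A \<times> B) (Z \<omega>, y) \<partial>\<eta>) \<partial>P)"
    proof (intro nn_integral_cong)
      fix \<omega> assume "\<omega> \<in> space P"
      then have [measurable]: "Z \<omega> \<in> space S" using Z \<open>\<omega> \<in> space P\<close> by (auto intro: measurable_space)
      have "(\<lambda>y. k (Z \<omega>, y)) \<in> borel_measurable \<eta>" by measurable
      then have "emeasure (density \<eta> (\<lambda>y. k (Z \<omega>, y))) B = (\<integral>\<^sup>+y. k (Z \<omega>, y) * indicator B y \<partial>\<eta>)"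
        by (subst emeasure_density) (auto simp: sets_eta)
      then show "indicator A (Z \<omega>) * emeasure (density \<eta> (\<lambda>y. k (Z \<omega>, y))) B
         = (\<integral>\<^sup>+y. k (Z \<omega>, y) * indicator (A \<times> B) (Z \<omega>, y) \<partial>\<eta>)"
        by (auto simp: indicator_times split: split_indicator)
    qed
    also have "\<dots> = (\<integral>\<^sup>+ z. (\<integral>\<^sup>+y. k (z, y) * indicator (A \<times> B) (z, y) \<partial>\<eta>) \<partial>?D)"
      by (subst nn_integral_distr) measurable
    also have "\<dots> = (\<integral>\<^sup>+ p. k p * indicator (A \<times> B) p \<partial>(?D \<Otimes>\<^sub>M \<eta>))"
      by (subst eta.nn_integral_fst[symmetric]) measurable
    also have "\<dots> = emeasure ?R X"
      unfolding X by (subst emeasure_density) measurable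
    finally show "emeasure ?L X = emeasure ?R X" .
  qed
  have "(\<integral>\<^sup>+\<omega>. g (Z \<omega>, Y \<omega>) \<partial>P) = (\<integral>\<^sup>+p. g p \<partial>?L)"
    by (subst nn_integral_distr) measurable
  also have "\<dots> = (\<integral>\<^sup>+p. k p * g p \<partial>(?D \<Otimes>\<^sub>M \<eta>))"
    unfolding * by (subst nn_integral_density) measurable
  also have "\<dots> = (\<integral>\<^sup>+ z. (\<integral>\<^sup>+y. k (z, y) * g (z, y) \<partial>\<eta>) \<partial>?D)"
    by (subst eta.nn_integral_fst[symmetric]) measurable
  also have "\<dots> = (\<integral>\<^sup>+\<omega>. (\<integral>\<^sup>+y. k (Z \<omega>, y) * g (Z \<omega>, y) \<partial>\<eta>) \<partial>P)"
    by (subst nn_integral_distr) measurable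
  finally show ?thesis .
qed

text \<open>Signed bounded version: \<open>g + B\<close> is nonnegative, so the preceding lemma
  applies to it, and the shift cancels because both sides integrate the constant \<open>B\<close>
  against probability measures. The kernel is normalised only almost surely, which is why the inner
  integral is identified almost everywhere.\<close>

lemma cond_law_density_integral:
  fixes k :: "'z \<times> 'y \<Rightarrow> real" and g :: "'y \<Rightarrow> real"
  assumes P: "prob_space P" and Z: "Z \<in> P \<rightarrow>\<^sub>M S" and Y: "Y \<in> P \<rightarrow>\<^sub>M T"
    and \<eta>: "sigma_finite_measure \<eta>" "sets \<eta> = sets T"
    and k: "k \<in> borel_measurable (S \<Otimes>\<^sub>M T)"
    and law: "cond_law P Z S Y T (\<lambda>z. density \<eta> (\<lambda>y. ennreal (k (z, y))))"
    and norm: "AE \<omega> in P. (\<integral>\<^sup>+y. ennreal (k (Z \<omega>, y)) \<partial>\<eta>) = 1"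
    and g: "g \<in> borel_measurable T" and bd: "\<And>y. y \<in> space T \<Longrightarrow> \<bar>g y\<bar> \<le> B"
  shows "integrable P (\<lambda>\<omega>. g (Y \<omega>))"
    and "integrable P (\<lambda>\<omega>. \<integral>y. g y \<partial>density \<eta> (\<lambda>y. ennreal (k (Z \<omega>, y))))"
    and "(\<integral>\<omega>. g (Y \<omega>) \<partial>P) = (\<integral>\<omega>. (\<integral>y. g y \<partial>density \<eta> (\<lambda>y. ennreal (k (Z \<omega>, y)))) \<partial>P)"
proof -
  interpret prob_space P by fact
  interpret eta: sigma_finite_measure \<eta> by fact
  have sets_eta[measurable_cong]: "sets \<eta> = sets T" by fact
  have space_eta: "space \<eta> = space T" using sets_eta by (rule sets_eq_imp_space_eq)
  note [measurable] = Z Y k g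
  have ke: "(\<lambda>p. ennreal (k p)) \<in> borel_measurable (S \<Otimes>\<^sub>M T)" by measurable
  have YT: "Y \<omega> \<in> space T" if "\<omega> \<in> space P" for \<omega> using Y that by (rule measurable_space)
  show int: "integrable P (\<lambda>\<omega>. g (Y \<omega>))"
    by (rule integrable_const_bound[of _ B]) (use bd YT in auto)
  let ?m = "\<lambda>\<omega>. density \<eta> (\<lambda>y. ennreal (k (Z \<omega>, y)))"
  \<comment> \<open>The inner integral of the shifted function, taken in the nonnegative extended
    reals where measurability in \<omega> comes from Tonelli, then moved back to the reals. It lies
    between 0 and \<open>2 * B\<close> wherever the kernel is normalised.\<close>
  define I where "I \<omega> = enn2real (\<integral>\<^sup>+y. ennreal (k (Z \<omega>, y)) * ennreal (g y + B) \<partial>\<eta>)" for \<omega>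
  have I_meas: "I \<in> borel_measurable P" unfolding I_def by measurable
  have B0: "g y + B \<ge> 0" "g y + B \<le> 2 * B" if "y \<in> space T" for y using bd[OF that] by linarith+
  have AE_I: "AE \<omega> in P. (\<integral>y. g y \<partial>?m \<omega>) = I \<omega> - B
     \<and> ennreal (I \<omega>) = (\<integral>\<^sup>+y. ennreal (k (Z \<omega>, y)) * ennreal (g y + B) \<partial>\<eta>) \<and> I \<omega> \<le> 2 * B"
    using norm
  proof (rule AE_mp, intro AE_I2 impI)
    fix \<omega> assume w: "\<omega> \<in> space P" and 1: "(\<integral>\<^sup>+y. ennreal (k (Z \<omega>, y)) \<partial>\<eta>) = 1"
    have ZS [measurable]: "Z \<omega> \<in> space S" using Z w by (rule measurable_space)
    have km [measurable]: "(\<lambda>y. k (Z \<omega>, y)) \<in> borel_measurable \<eta>" by measurable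
    have "prob_space (?m \<omega>)"
      by (rule prob_spaceI) (use 1 in \<open>simp add: emeasure_density cong: nn_integral_cong\<close>)
    then interpret m: prob_space "?m \<omega>" .
    have gm: "g \<in> borel_measurable (?m \<omega>)" by measurable
    have gi: "integrable (?m \<omega>) g"
      by (rule m.integrable_const_bound[of _ B]) (use gm bd space_eta in auto)
    have eq: "(\<integral>\<^sup>+y. ennreal (g y + B) \<partial>?m \<omega>) = (\<integral>\<^sup>+y. ennreal (k (Z \<omega>, y)) * ennreal (g y + B) \<partial>\<eta>)"
      by (subst nn_integral_density) measurable
    have "(\<integral>y. g y + B \<partial>?m \<omega>) = enn2real (\<integral>\<^sup>+y. ennreal (g y + B) \<partial>?m \<omega>)"
      by (rule integral_eq_nn_integral) (use gm B0 space_eta in \<open>auto intro!: AE_I2\<close>)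
    then have II: "(\<integral>y. g y + B \<partial>?m \<omega>) = I \<omega>" unfolding eq I_def .
    have "(\<integral>y. g y + B \<partial>?m \<omega>) = (\<integral>y. g y \<partial>?m \<omega>) + B"
      by (simp only: Bochner_Integration.integral_add[OF gi m.integrable_const] lebesgue_integral_const m.prob_space scaleR_one)
    moreover have "(\<integral>\<^sup>+y. ennreal (g y + B) \<partial>?m \<omega>) \<le> (\<integral>\<^sup>+y. ennreal (2 * B) \<partial>?m \<omega>)"
      by (intro nn_integral_mono ennreal_leI) (use B0 space_eta in auto)
    then have fin: "(\<integral>\<^sup>+y. ennreal (k (Z \<omega>, y)) * ennreal (g y + B) \<partial>\<eta>) \<le> ennreal (2 * B)"
      unfolding eq nn_integral_const m.emeasure_space_1 mult_1_right .
    then have "(\<integral>\<^sup>+y. ennreal (k (Z \<omega>, y)) * ennreal (g y + B) \<partial>\<eta>) < top"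
      by (rule le_less_trans) simp
    then have "ennreal (I \<omega>) = (\<integral>\<^sup>+y. ennreal (k (Z \<omega>, y)) * ennreal (g y + B) \<partial>\<eta>)"
      unfolding I_def by (rule ennreal_enn2real)
    moreover have "I \<omega> \<le> 2 * B"
    proof -
      \<comment> \<open>A probability space has a point, and \<open>B\<close> dominates an absolute
        value there.\<close>
      have "0 \<le> B" using m.not_empty bd space_eta by fastforce
      then show ?thesis using enn2real_mono[OF fin] by (simp add: I_def)
    qed
    ultimately show "(\<integral>y. g y \<partial>?m \<omega>) = I \<omega> - B
     \<and> ennreal (I \<omega>) = (\<integral>\<^sup>+y. ennreal (k (Z \<omega>, y)) * ennreal (g y + B) \<partial>\<eta>) \<and> I \<omega> \<le> 2 * B"
      using II by simp
  qed
  have I0: "I \<omega> \<ge> 0" for \<omega> by (simp add: I_def)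
  have Iint: "integrable P I"
    by (rule integrable_const_bound[of _ "2 * B"]) (use AE_I I_meas I0 in auto)
  \<comment> \<open>\<open>ennreal\<close> truncates negative values of \<open>k\<close>, so
    \<open>max 0 k\<close> defines the same measure. With this nonnegative density the Bochner
    integral becomes one over the fixed measure \<eta>, hence measurable in \<omega>.\<close>
  have m_eq: "(\<integral>y. g y \<partial>?m \<omega>) = (\<integral>y. max 0 (k (Z \<omega>, y)) * g y \<partial>\<eta>)" if "\<omega> \<in> space P" for \<omega>
  proof -
    have [measurable]: "Z \<omega> \<in> space S" using Z that by (rule measurable_space)
    have km: "(\<lambda>y. max 0 (k (Z \<omega>, y))) \<in> borel_measurable \<eta>" by measurable
    have "?m \<omega> = density \<eta> (\<lambda>y. ennreal (max 0 (k (Z \<omega>, y))))"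
      by (intro arg_cong[where f = "density \<eta>"] ext) (auto simp: max_def ennreal_neg)
    moreover have "(\<integral>y. g y \<partial>density \<eta> (\<lambda>y. ennreal (max 0 (k (Z \<omega>, y)))))
        = (\<integral>y. max 0 (k (Z \<omega>, y)) *\<^sub>R g y \<partial>\<eta>)"
      by (rule integral_density[OF _ km]) auto
    ultimately show ?thesis by simp
  qed
  have m_meas [measurable]: "(\<lambda>\<omega>. \<integral>y. g y \<partial>?m \<omega>) \<in> borel_measurable P"
    by (subst measurable_cong[OF m_eq]) (assumption, measurable)
  show int2: "integrable P (\<lambda>\<omega>. \<integral>y. g y \<partial>?m \<omega>)"
    by (subst integrable_cong_AE[where g = "\<lambda>\<omega>. I \<omega> - B"]) (use AE_I I_meas Iint in auto)
  have "(\<integral>\<^sup>+\<omega>. ennreal (g (Y \<omega>) + B) \<partial>P) = (\<integral>\<^sup>+\<omega>. (\<integral>\<^sup>+y. ennreal (k (Z \<omega>, y)) * ennreal (g y + B) \<partial>\<eta>) \<partial>P)"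
    using cond_law_density_nn_integral[OF P Z Y \<eta> ke law, of "\<lambda>(z, y). ennreal (g y + B)"] by simp
  also have "\<dots> = (\<integral>\<^sup>+\<omega>. ennreal (I \<omega>) \<partial>P)"
    by (rule nn_integral_cong_AE) (use AE_I in auto)
  finally have "enn2real (\<integral>\<^sup>+\<omega>. ennreal (g (Y \<omega>) + B) \<partial>P) = enn2real (\<integral>\<^sup>+\<omega>. ennreal (I \<omega>) \<partial>P)" by simp
  then have "(\<integral>\<omega>. g (Y \<omega>) + B \<partial>P) = (\<integral>\<omega>. I \<omega> \<partial>P)"
    by (subst (1 2) integral_eq_nn_integral) (use I0 I_meas B0 YT in \<open>auto intro!: AE_I2\<close>)
  then have "(\<integral>\<omega>. g (Y \<omega>) \<partial>P) = (\<integral>\<omega>. I \<omega> - B \<partial>P)"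
    using int Iint by (simp add: prob_space)
  also have "\<dots> = (\<integral>\<omega>. (\<integral>y. g y \<partial>?m \<omega>) \<partial>P)"
    by (rule integral_cong_AE) (use AE_I I_meas int2 in auto)
  finally show "(\<integral>\<omega>. g (Y \<omega>) \<partial>P) = (\<integral>\<omega>. (\<integral>y. g y \<partial>?m \<omega>) \<partial>P)" .
qed

section \<open>Relative entropy and Hellinger affinity\<close>

text \<open>The Radon-Nikodym derivative of a measure with respect to itself is 1 almost everywhere,
  so its logarithm vanishes. This serves to refute equality of two laws whose relative entropy is
  positive.\<close>

lemma rel_entropy_self:
  assumes "prob_space \<rho>"
  shows "rel_entropy \<rho> \<rho> = 0"
proof -
  interpret prob_space \<rho> by fact
  have "AE z in \<rho>. 1 = RN_deriv \<rho> \<rho> z"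
    by (rule RN_deriv_unique) (simp_all add: density_1)
  then have *: "AE z in \<rho>. entropy_density (exp 1) \<rho> \<rho> z = 0"
    by eventually_elim (simp add: entropy_density_def)
  have "(\<integral>\<^sup>+ z. ennreal (entropy_density (exp 1) \<rho> \<rho> z) \<partial>\<rho>) = (\<integral>\<^sup>+ z. 0 \<partial>\<rho>)"
    "(\<integral>\<^sup>+ z. ennreal (- entropy_density (exp 1) \<rho> \<rho> z) \<partial>\<rho>) = (\<integral>\<^sup>+ z. 0 \<partial>\<rho>)"
    by (rule nn_integral_cong_AE, use * in eventually_elim, simp)+
  then show ?thesis
    by (simp add: rel_entropy_def absolutely_continuous_def zero_ereal_def[symmetric] zero_ennreal.rep_eq)
qed

text \<open>Both facts rest on \<open>\<surd>(p q) + (\<surd>p - \<surd>q)\<^sup>2 / 2 = (p + q) / 2\<close>.\<close>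

lemma
  fixes p q :: "'a \<Rightarrow> real"
  assumes [measurable]: "p \<in> borel_measurable N" "q \<in> borel_measurable N"
    and p0: "\<And>z. z \<in> space N \<Longrightarrow> 0 \<le> p z" and q0: "\<And>z. z \<in> space N \<Longrightarrow> 0 \<le> q z"
    and p1: "(\<integral>\<^sup>+z. ennreal (p z) \<partial>N) = 1" and q1: "(\<integral>\<^sup>+z. ennreal (q z) \<partial>N) = 1"
  shows hellinger_affinity_le_1: "(\<integral>\<^sup>+z. ennreal (sqrt (p z * q z)) \<partial>N) \<le> 1"
    and hellinger_affinity_eq_1: "(\<integral>\<^sup>+z. ennreal (sqrt (p z * q z)) \<partial>N) = 1 \<Longrightarrow> AE z in N. p z = q z"
proof -
  define h :: real where "h = 1 / 2"
  have h0: "0 \<le> h" and h2: "h + h = 1" by (simp_all add: h_def)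
  have id: "a * b + (a - b)\<^sup>2 / 2 = h * a\<^sup>2 + h * b\<^sup>2" for a b :: real
    by (simp add: h_def power2_eq_square field_simps)
  have "(\<integral>\<^sup>+z. ennreal (sqrt (p z * q z)) \<partial>N) + (\<integral>\<^sup>+z. ennreal ((sqrt (p z) - sqrt (q z))\<^sup>2 / 2) \<partial>N)
      = (\<integral>\<^sup>+z. ennreal (sqrt (p z * q z)) + ennreal ((sqrt (p z) - sqrt (q z))\<^sup>2 / 2) \<partial>N)"
    by (rule nn_integral_add[symmetric]) measurable
  also have "\<dots> = (\<integral>\<^sup>+z. ennreal h * ennreal (p z) + ennreal h * ennreal (q z) \<partial>N)"
  proof (intro nn_integral_cong)
    fix z assume z: "z \<in> space N"
    have "sqrt (p z * q z) + (sqrt (p z) - sqrt (q z))\<^sup>2 / 2 = h * p z + h * q z"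
      using p0[OF z] q0[OF z] id[of "sqrt (p z)" "sqrt (q z)"] by (simp add: real_sqrt_mult)
    then show "ennreal (sqrt (p z * q z)) + ennreal ((sqrt (p z) - sqrt (q z))\<^sup>2 / 2)
        = ennreal h * ennreal (p z) + ennreal h * ennreal (q z)"
      using p0[OF z] q0[OF z] h0
      by (simp only: ennreal_plus[symmetric] ennreal_mult[symmetric] mult_nonneg_nonneg
          real_sqrt_ge_zero zero_le_power2 divide_nonneg_pos zero_less_numeral)
  qed
  also have "\<dots> = ennreal h * (\<integral>\<^sup>+z. ennreal (p z) \<partial>N) + ennreal h * (\<integral>\<^sup>+z. ennreal (q z) \<partial>N)"
    by (simp add: nn_integral_add nn_integral_cmult)
  also have "\<dots> = 1" using ennreal_plus[OF h0 h0] by (simp add: p1 q1 h2)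
  finally have *: "(\<integral>\<^sup>+z. ennreal (sqrt (p z * q z)) \<partial>N)
      + (\<integral>\<^sup>+z. ennreal ((sqrt (p z) - sqrt (q z))\<^sup>2 / 2) \<partial>N) = 1" .
  then show "(\<integral>\<^sup>+z. ennreal (sqrt (p z * q z)) \<partial>N) \<le> 1"
    by (metis le_iff_add)
  assume "(\<integral>\<^sup>+z. ennreal (sqrt (p z * q z)) \<partial>N) = 1"
  \<comment> \<open>Affinity 1 leaves nothing for the squared difference of the roots: cancelling
    the finite 1 makes its integral zero.\<close>
  with * have "1 + (\<integral>\<^sup>+z. ennreal ((sqrt (p z) - sqrt (q z))\<^sup>2 / 2) \<partial>N) = 1 + 0"
    by simp
  then have "(\<integral>\<^sup>+z. ennreal ((sqrt (p z) - sqrt (q z))\<^sup>2 / 2) \<partial>N) = 0"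
    unfolding ennreal_add_left_cancel by simp
  then have "AE z in N. ennreal ((sqrt (p z) - sqrt (q z))\<^sup>2 / 2) = 0"
    by (subst (asm) nn_integral_0_iff_AE) auto
  then show "AE z in N. p z = q z"
    by (rule AE_mp) (use p0 q0 in \<open>auto intro!: AE_I2 simp: ennreal_eq_0_iff\<close>)
qed

section \<open>Elementary bounds for posterior weights, expectations and discounted sums\<close>

text \<open>After squaring, the claim for \<open>s = a + b\<close> is
  \<open>a * b \<le> (a + b)\<^sup>2\<close>. In the application \<open>a\<close> and
  \<open>b\<close> are the weights of a wrong parameter and of the true one, and \<open>s\<close> is
  the normalising sum of the posterior.\<close>

lemma ratio_le_sqrt:
  fixes a b s :: real
  assumes "0 < a" "0 < b" "a + b \<le> s"
  shows "a / s \<le> sqrt (a / b)"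
proof -
  have "a / s \<le> a / (a + b)" using assms by (intro divide_left_mono) auto
  also have "\<dots> \<le> sqrt (a / b)"
  proof (rule real_le_rsqrt)
    have "a * a * b \<le> a * (a + b)\<^sup>2" using assms by (simp add: power2_eq_square algebra_simps)
    then show "(a / (a + b))\<^sup>2 \<le> a / b"
      using assms by (simp add: power_divide frac_le_eq divide_simps power2_eq_square)
  qed
  finally show ?thesis .
qed

lemma abs_integral_le_prob:
  fixes f :: "'a \<Rightarrow> real"
  assumes "prob_space N" "f \<in> borel_measurable N" and bd: "\<And>y. y \<in> space N \<Longrightarrow> \<bar>f y\<bar> \<le> B"
  shows "\<bar>\<integral>y. f y \<partial>N\<bar> \<le> B"
proof -
  interpret prob_space N by fact
  have i: "integrable N f"
    by (rule integrable_const_bound[of _ B]) (use assms in auto)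
  have "(\<integral>y. f y \<partial>N) \<le> B"
    by (rule integral_le_const[OF i]) (use bd in \<open>force intro!: AE_I2\<close>)
  moreover have "- B \<le> (\<integral>y. f y \<partial>N)"
    by (rule integral_ge_const[OF i]) (use bd in \<open>force intro!: AE_I2\<close>)
  ultimately show ?thesis by simp
qed

text \<open>Summing the step inequality with weights \<open>\<beta> ^ k\<close> from time
  \<open>n\<close> on telescopes the terms \<open>e\<close>. The remainder
  \<open>\<beta> ^ N * e (n + N)\<close> vanishes because \<open>e\<close> is bounded, and the
  errors form a geometric series.\<close>

lemma discounted_telescope_bound:
  fixes e r :: "nat \<Rightarrow> real"
  assumes \<beta>: "0 \<le> \<beta>" "\<beta> < 1" and K: "0 \<le> K" and b: "0 \<le> b"
    and step: "\<And>t. e t - r t - \<beta> * e (Suc t) \<le> K * exp (- b * real t)"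
    and bd: "\<And>t. \<bar>e t\<bar> \<le> B"
    and sums: "(\<lambda>k. \<beta> ^ k * r (n + k)) sums V"
  shows "e n - V \<le> K * exp (- b * real n) / (1 - \<beta>)"
proof -
  have part: "e n - \<beta> ^ N * e (n + N) - (\<Sum>k<N. \<beta> ^ k * r (n + k))
     \<le> (\<Sum>k<N. \<beta> ^ k * (K * exp (- b * real n)))" for N
  proof (induction N)
    case (Suc N)
    \<comment> \<open>The decay between \<open>n\<close> and \<open>n + N\<close> is given away:
      every error is bounded by its value at time \<open>n\<close>, which leaves the plain factor
      \<open>1 / (1 - \<beta>)\<close>.\<close>
    have "e (n + N) - r (n + N) - \<beta> * e (Suc (n + N)) \<le> K * exp (- b * real n)"
      using step[of "n + N"] by (rule order_trans) (use K b in \<open>auto intro!: mult_left_mono\<close>)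
    then have "\<beta> ^ N * (e (n + N) - r (n + N) - \<beta> * e (Suc (n + N))) \<le> \<beta> ^ N * (K * exp (- b * real n))"
      using \<beta> by (intro mult_left_mono) auto
    with Suc show ?case by (simp add: algebra_simps)
  qed simp
  have "(\<lambda>N. \<beta> ^ N * e (n + N)) \<longlonglongrightarrow> 0"
  proof (rule Lim_null_comparison)
    show "\<forall>\<^sub>F N in sequentially. norm (\<beta> ^ N * e (n + N)) \<le> \<beta> ^ N * B"
      using \<beta> bd by (auto simp: abs_mult intro!: always_eventually mult_left_mono)
    show "(\<lambda>N. \<beta> ^ N * B) \<longlonglongrightarrow> 0"
      using \<beta> by (intro tendsto_mult_left_zero LIMSEQ_power_zero) auto
  qed
  then have "(\<lambda>N. e n - \<beta> ^ N * e (n + N) - (\<Sum>k<N. \<beta> ^ k * r (n + k))) \<longlonglongrightarrow> e n - 0 - V"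
    using sums by (intro tendsto_intros) (auto simp: sums_def)
  moreover have "(\<lambda>k. \<beta> ^ k * (K * exp (- b * real n))) sums (1 / (1 - \<beta>) * (K * exp (- b * real n)))"
    using \<beta> by (intro sums_mult2 geometric_sums) auto
  then have "(\<lambda>N. \<Sum>k<N. \<beta> ^ k * (K * exp (- b * real n))) \<longlonglongrightarrow> 1 / (1 - \<beta>) * (K * exp (- b * real n))"
    by (simp add: sums_def)
  ultimately have "e n - 0 - V \<le> 1 / (1 - \<beta>) * (K * exp (- b * real n))"
    by (rule LIMSEQ_le) (use part in blast)
  then show ?thesis by simp
qed

section \<open>Likelihood ratios in the controlled model\<close>

text \<open>The integrand defining \<open>joint_law\<close>, before its conversion by
  \<open>ennreal\<close>.\<close>

definition pair_dens :: "('x, 'u, 'p) model \<Rightarrow> 'p \<Rightarrow> 'x \<Rightarrow> 'u \<Rightarrow> real \<times> 'x \<Rightarrow> real" where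
  "pair_dens M \<gamma> x u = (\<lambda>(r, y). rew_dens M \<gamma> x u r * trans_dens M \<gamma> x u y)"

text \<open>Bhattacharyya coefficient of the joint laws of reward and next state under two
  parameters; it does not exceed 1 on admissible pairs.\<close>

definition affinity :: "('x, 'u, 'p) model \<Rightarrow> 'p \<Rightarrow> 'p \<Rightarrow> 'x \<Rightarrow> 'u \<Rightarrow> ennreal" where
  "affinity M \<theta> \<gamma> x u = (\<integral>\<^sup>+z. ennreal (sqrt (pair_dens M \<theta> x u z * pair_dens M \<gamma> x u z))
     \<partial>(rew_ref M \<Otimes>\<^sub>M state_ref M))"

text \<open>The process \<open>W\<close> of the overview. When the densities are positive, the
  likelihood ratio itself has conditional one-step factor 1 under \<theta> and does not decay in
  mean; its square root has the affinity as factor.\<close>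

definition sqrt_ratio ::
  "('x, 'u, 'p) model \<Rightarrow> 'p \<Rightarrow> 'p \<Rightarrow> nat \<Rightarrow> ('x, 'p \<times> 'u \<times> real) history \<Rightarrow> real" where
  "sqrt_ratio M \<theta> \<gamma> t h = sqrt (likelihood M \<gamma> t h / likelihood M \<theta> t h)"

text \<open>The state at time \<open>t\<close> is the separate last component of
  \<open>hist t\<close> but belongs to a stored step of \<open>hist (Suc t)\<close>.
  \<open>hist_state\<close> reads the same value from both, so the first \<open>t\<close> factors
  agree and exactly one factor is new.\<close>

lemma likelihood_Suc:
  "likelihood M \<gamma> (Suc t) (hist (Suc t) \<omega>) = likelihood M \<gamma> t (hist t \<omega>)
     * pair_dens M \<gamma> (ts_state t \<omega>) (ts_control t \<omega>) (ts_reward t \<omega>, ts_state (Suc t) \<omega>)"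
proof -
  have "hist_state (Suc t) (hist (Suc t) \<omega>) s = hist_state t (hist t \<omega>) s" if "s \<le> t" for s
    using that by (auto simp: hist_state_def hist_def)
  moreover have "ts_control (s - 1) (fst (hist (Suc t) \<omega>)) = ts_control (s - 1) (fst (hist t \<omega>))"
      "ts_reward (s - 1) (fst (hist (Suc t) \<omega>)) = ts_reward (s - 1) (fst (hist t \<omega>))"
    if "s \<in> {1..t}" for s
    using that by (auto simp: hist_def ts_control_def ts_reward_def)
  moreover have "hist_state t (hist t \<omega>) t = ts_state t \<omega>"
    "hist_state (Suc t) (hist (Suc t) \<omega>) (Suc t) = ts_state (Suc t) \<omega>"
    "ts_control t (fst (hist (Suc t) \<omega>)) = ts_control t \<omega>"
    "ts_reward t (fst (hist (Suc t) \<omega>)) = ts_reward t \<omega>"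
    by (simp_all add: hist_state_def hist_def ts_state_def ts_control_def ts_reward_def)
  moreover have "hist_state t (hist t \<omega>) (s - 1) = hist_state (Suc t) (hist (Suc t) \<omega>) (s - 1)"
    if "s \<in> {1..t}" for s
    using that by (auto simp: hist_state_def hist_def)
  ultimately show ?thesis
    by (simp add: likelihood_def pair_dens_def)
qed

lemma likelihood_0: "likelihood M \<gamma> 0 h = 1"
  by (simp add: likelihood_def)

locale controlled_model =
  fixes M :: "('x::polish_space, 'u::polish_space, 'p) model"
  assumes valid: "valid_model M"
begin

abbreviation "SS \<equiv> state_space M"
abbreviation "CS \<equiv> control_space M"
abbreviation "RS \<equiv> reward_space M"
abbreviation "S \<equiv> ts_step_space M"
abbreviation "\<Lambda> \<equiv> rew_ref M"
abbreviation "H \<equiv> state_ref M"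
abbreviation "Pa \<equiv> count_space (params M)"

lemma finite_params: "finite (params M)"
  and compact_rewards: "compact (rewards M)"
  and disc_nonneg: "0 \<le> disc M" and disc_less_1: "disc M < 1"
  and sets_rew_ref [measurable_cong]: "sets \<Lambda> = sets RS"
  and sets_state_ref [measurable_cong]: "sets H = sets SS"
  using valid by (auto simp: valid_model_def)

lemma space_SS [simp]: "space SS = states M"
  and space_CS [simp]: "space CS = controls M"
  and space_RS [simp]: "space RS = rewards M"
  by (simp_all add: state_space_def control_space_def reward_space_def space_restrict_space)

lemma space_rew_ref [simp]: "space \<Lambda> = rewards M"
  and space_state_ref [simp]: "space H = states M"
  using sets_eq_imp_space_eq[OF sets_rew_ref] sets_eq_imp_space_eq[OF sets_state_ref] by simp_all

sublocale rew: sigma_finite_measure \<Lambda> using valid by (simp add: valid_model_def)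
sublocale st: sigma_finite_measure H using valid by (simp add: valid_model_def)
sublocale pair_sigma_finite \<Lambda> H ..

lemma adm_pairs_iff: "(x, u) \<in> adm_pairs M \<longleftrightarrow> x \<in> states M \<and> u \<in> adm M x"
  by (simp add: adm_pairs_def)

lemma adm_in_controls: "x \<in> states M \<Longrightarrow> u \<in> adm M x \<Longrightarrow> u \<in> controls M"
  by (auto simp: controls_def)

section \<open>Measurability, sign and normalisation of the densities\<close>

lemma measurable_rew_dens [measurable (raw)]:
  assumes "\<gamma> \<in> params M" "a \<in> A \<rightarrow>\<^sub>M SS" "b \<in> A \<rightarrow>\<^sub>M CS" "r \<in> A \<rightarrow>\<^sub>M RS"
  shows "(\<lambda>z. rew_dens M \<gamma> (a z) (b z) (r z)) \<in> borel_measurable A"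
proof -
  have "(\<lambda>((x, u), r). rew_dens M \<gamma> x u r) \<in> borel_measurable ((SS \<Otimes>\<^sub>M CS) \<Otimes>\<^sub>M RS)"
    using valid assms(1) by (simp add: valid_model_def)
  from measurable_compose[OF _ this, of "\<lambda>z. ((a z, b z), r z)" A] show ?thesis
    using assms(2-4) by simp
qed

lemma measurable_trans_dens [measurable (raw)]:
  assumes "\<gamma> \<in> params M" "a \<in> A \<rightarrow>\<^sub>M SS" "b \<in> A \<rightarrow>\<^sub>M CS" "y \<in> A \<rightarrow>\<^sub>M SS"
  shows "(\<lambda>z. trans_dens M \<gamma> (a z) (b z) (y z)) \<in> borel_measurable A"
proof -
  have "(\<lambda>((x, u), y). trans_dens M \<gamma> x u y) \<in> borel_measurable ((SS \<Otimes>\<^sub>M CS) \<Otimes>\<^sub>M SS)"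
    using valid assms(1) by (simp add: valid_model_def)
  from measurable_compose[OF _ this, of "\<lambda>z. ((a z, b z), y z)" A] show ?thesis
    using assms(2-4) by simp
qed

lemma measurable_pair_dens [measurable (raw)]:
  assumes [measurable]: "\<gamma> \<in> params M" "a \<in> A \<rightarrow>\<^sub>M SS" "b \<in> A \<rightarrow>\<^sub>M CS" "z \<in> A \<rightarrow>\<^sub>M RS \<Otimes>\<^sub>M SS"
  shows "(\<lambda>w. pair_dens M \<gamma> (a w) (b w) (z w)) \<in> borel_measurable A"
  unfolding pair_dens_def by measurable

lemma dens_nonneg:
  assumes "\<gamma> \<in> params M" "(x, u) \<in> adm_pairs M"
  shows "r \<in> rewards M \<Longrightarrow> 0 \<le> rew_dens M \<gamma> x u r" "y \<in> states M \<Longrightarrow> 0 \<le> trans_dens M \<gamma> x u y"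
  using valid assms unfolding valid_model_def by blast+

lemma nn_integral_dens:
  assumes "\<gamma> \<in> params M" "(x, u) \<in> adm_pairs M"
  shows "(\<integral>\<^sup>+ r. ennreal (rew_dens M \<gamma> x u r) \<partial>\<Lambda>) = 1"
    "(\<integral>\<^sup>+ y. ennreal (trans_dens M \<gamma> x u y) \<partial>H) = 1"
  using valid assms unfolding valid_model_def by blast+

lemma nn_integral_pair_dens:
  assumes g: "\<gamma> \<in> params M" and xu: "(x, u) \<in> adm_pairs M"
  shows "(\<integral>\<^sup>+ z. ennreal (pair_dens M \<gamma> x u z) \<partial>(\<Lambda> \<Otimes>\<^sub>M H)) = 1"
proof -
  have [measurable]: "x \<in> space SS" "u \<in> space CS"
    using xu by (auto simp: adm_pairs_iff intro: adm_in_controls)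
  note [measurable] = g
  have "(\<integral>\<^sup>+ z. ennreal (pair_dens M \<gamma> x u z) \<partial>(\<Lambda> \<Otimes>\<^sub>M H))
    = (\<integral>\<^sup>+ r. \<integral>\<^sup>+ y. ennreal (pair_dens M \<gamma> x u (r, y)) \<partial>H \<partial>\<Lambda>)"
    by (rule st.nn_integral_fst[symmetric]) measurable
  also have "\<dots> = (\<integral>\<^sup>+ r. \<integral>\<^sup>+ y. ennreal (rew_dens M \<gamma> x u r) * ennreal (trans_dens M \<gamma> x u y) \<partial>H \<partial>\<Lambda>)"
    using dens_nonneg[OF g xu]
    by (intro nn_integral_cong) (auto simp: pair_dens_def ennreal_mult)
  also have "\<dots> = (\<integral>\<^sup>+ r. ennreal (rew_dens M \<gamma> x u r) * (\<integral>\<^sup>+ y. ennreal (trans_dens M \<gamma> x u y) \<partial>H) \<partial>\<Lambda>)"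
    by (intro nn_integral_cong nn_integral_cmult) measurable
  also have "\<dots> = 1" by (simp add: nn_integral_dens[OF g xu])
  finally show ?thesis .
qed

lemma pair_dens_nonneg:
  assumes "\<gamma> \<in> params M" "(x, u) \<in> adm_pairs M" "z \<in> rewards M \<times> states M"
  shows "0 \<le> pair_dens M \<gamma> x u z"
  using dens_nonneg[OF assms(1,2)] assms(3) by (auto simp: pair_dens_def)

section \<open>Affinities of the joint laws at admissible pairs\<close>

lemma affinity_le_1:
  assumes "\<theta> \<in> params M" "\<gamma> \<in> params M" "(x, u) \<in> adm_pairs M"
  shows "affinity M \<theta> \<gamma> x u \<le> 1"
proof -
  have [measurable]: "x \<in> space SS" "u \<in> space CS"
    using assms by (auto simp: adm_pairs_iff intro: adm_in_controls)
  note [measurable] = assms(1,2)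
  show ?thesis unfolding affinity_def
    by (rule hellinger_affinity_le_1)
      (use assms nn_integral_pair_dens pair_dens_nonneg in \<open>auto simp: space_pair_measure\<close>)
qed

text \<open>Affinity 1 forces the two densities to agree almost everywhere, so the two laws coincide
  and their relative entropy is 0. The gap below 1 obtained this way depends on the pair
  \<open>(x, u)\<close>.\<close>

lemma affinity_less_1:
  assumes "\<theta> \<in> params M" "\<gamma> \<in> params M" "(x, u) \<in> adm_pairs M"
    and sep: "0 < rel_entropy (joint_law M \<theta> x u) (joint_law M \<gamma> x u)"
  shows "affinity M \<theta> \<gamma> x u < 1"
proof (rule ccontr)
  have [measurable]: "x \<in> space SS" "u \<in> space CS"
    using assms by (auto simp: adm_pairs_iff intro: adm_in_controls)
  note [measurable] = assms(1,2)
  assume "\<not> affinity M \<theta> \<gamma> x u < 1"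
  then have 1: "affinity M \<theta> \<gamma> x u = 1" using affinity_le_1[OF assms(1-3)] by simp
  have ae: "AE z in \<Lambda> \<Otimes>\<^sub>M H. pair_dens M \<theta> x u z = pair_dens M \<gamma> x u z"
    by (rule hellinger_affinity_eq_1[OF _ _ _ _ _ _ 1[unfolded affinity_def]])
      (use assms nn_integral_pair_dens pair_dens_nonneg in \<open>auto simp: space_pair_measure\<close>)
  have law: "joint_law M \<gamma>' x u = density (\<Lambda> \<Otimes>\<^sub>M H) (\<lambda>z. ennreal (pair_dens M \<gamma>' x u z))" for \<gamma>'
    by (simp add: joint_law_def pair_dens_def split_def)
  have "joint_law M \<theta> x u = joint_law M \<gamma> x u"
    unfolding law by (rule density_cong) (measurable, use ae in auto)
  moreover have "prob_space (joint_law M \<gamma> x u)"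
  proof (rule prob_spaceI)
    have "emeasure (joint_law M \<gamma> x u) (space (joint_law M \<gamma> x u))
        = (\<integral>\<^sup>+ z. ennreal (pair_dens M \<gamma> x u z) \<partial>(\<Lambda> \<Otimes>\<^sub>M H))"
      unfolding law by (simp add: emeasure_density cong: nn_integral_cong)
    then show "emeasure (joint_law M \<gamma> x u) (space (joint_law M \<gamma> x u)) = 1"
      using nn_integral_pair_dens[OF assms(2,3)] by simp
  qed
  ultimately show False using sep rel_entropy_self by force
qed

lemma measurable_affinity [measurable (raw)]:
  assumes [measurable]: "\<theta> \<in> params M" "\<gamma> \<in> params M" "a \<in> A \<rightarrow>\<^sub>M SS" "b \<in> A \<rightarrow>\<^sub>M CS"
  shows "(\<lambda>w. affinity M \<theta> \<gamma> (a w) (b w)) \<in> borel_measurable A"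
  unfolding affinity_def by measurable

section \<open>Likelihoods, transition laws and expected rewards\<close>

lemma measurable_likelihood:
  assumes [measurable]: "\<gamma> \<in> params M"
  shows "likelihood M \<gamma> t \<in> borel_measurable (hist_space M S t)"
proof -
  have state: "(\<lambda>h. hist_state t h s) \<in> hist_space M S t \<rightarrow>\<^sub>M SS" for s
  proof (cases "s < t")
    case True
    then have [measurable]: "s \<in> {..<t}" by simp
    have "(\<lambda>h. fst h s) \<in> hist_space M S t \<rightarrow>\<^sub>M S"
      unfolding hist_space_def by measurable
    have "(\<lambda>h. fst (fst h s)) \<in> hist_space M S t \<rightarrow>\<^sub>M SS"
      by (rule measurable_compose[OF \<open>(\<lambda>h. fst h s) \<in> _\<close>]) (simp add: ts_step_space_def)
    then show ?thesis using True by (simp add: hist_state_def)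
  next
    case False
    then show ?thesis by (simp add: hist_state_def hist_space_def)
  qed
  have cr: "(\<lambda>h. ts_control s (fst h)) \<in> hist_space M S t \<rightarrow>\<^sub>M CS"
    "(\<lambda>h. ts_reward s (fst h)) \<in> hist_space M S t \<rightarrow>\<^sub>M RS" if "s < t" for s
  proof -
    have [measurable]: "s \<in> {..<t}" using that by simp
    have m: "(\<lambda>h. fst h s) \<in> hist_space M S t \<rightarrow>\<^sub>M S"
      unfolding hist_space_def by measurable
    show "(\<lambda>h. ts_control s (fst h)) \<in> hist_space M S t \<rightarrow>\<^sub>M CS"
      "(\<lambda>h. ts_reward s (fst h)) \<in> hist_space M S t \<rightarrow>\<^sub>M RS"
      unfolding ts_control_def ts_reward_def
      by (rule measurable_compose[OF m], simp add: ts_step_space_def)+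
  qed
  show ?thesis unfolding likelihood_def
    by (intro borel_measurable_prod borel_measurable_times measurable_rew_dens measurable_trans_dens
        assms state cr) auto
qed

lemma prob_space_trans_law:
  assumes "\<gamma> \<in> params M" "(x, u) \<in> adm_pairs M"
  shows "prob_space (trans_law M \<gamma> x u)"
proof -
  have [measurable]: "x \<in> space SS" "u \<in> space CS"
    using assms by (auto simp: adm_pairs_iff intro: adm_in_controls)
  note [measurable] = assms(1)
  have m: "(\<lambda>y. ennreal (trans_dens M \<gamma> x u y)) \<in> borel_measurable H" by measurable
  have "emeasure (trans_law M \<gamma> x u) (space H) = (\<integral>\<^sup>+y. ennreal (trans_dens M \<gamma> x u y) * indicator (space H) y \<partial>H)"
    unfolding trans_law_def by (rule emeasure_density[OF m sets.top])
  also have "\<dots> = (\<integral>\<^sup>+y. ennreal (trans_dens M \<gamma> x u y) \<partial>H)"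
    by (intro nn_integral_cong) auto
  also have "\<dots> = 1"
    by (rule nn_integral_dens(2)[OF assms])
  finally show ?thesis by (intro prob_spaceI) (simp add: trans_law_def)
qed

lemma sets_trans_law [measurable_cong]: "sets (trans_law M \<gamma> x u) = sets SS"
  by (simp add: trans_law_def sets_state_ref)

lemma space_trans_law [simp]: "space (trans_law M \<gamma> x u) = states M"
  by (simp add: trans_law_def)

lemma exp_reward_eq:
  assumes "\<gamma> \<in> params M" "(x, u) \<in> adm_pairs M"
  shows "(\<integral>r. r \<partial>reward_law M \<gamma> x u) = exp_reward M \<gamma> x u"
proof -
  have [measurable]: "x \<in> space SS" "u \<in> space CS"
    using assms by (auto simp: adm_pairs_iff intro: adm_in_controls)
  note [measurable] = assms(1)
  have [measurable]: "(\<lambda>r. r) \<in> borel_measurable \<Lambda>"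
    by (subst measurable_cong_sets[OF sets_rew_ref refl])
      (simp add: reward_space_def measurable_restrict_space1)
  have m: "rew_dens M \<gamma> x u \<in> borel_measurable \<Lambda>" by measurable
  have "(\<integral>r. r \<partial>reward_law M \<gamma> x u) = (\<integral>r. rew_dens M \<gamma> x u r *\<^sub>R r \<partial>\<Lambda>)"
    unfolding reward_law_def
    by (rule integral_density[OF _ m]) (measurable, use dens_nonneg(1)[OF assms] in \<open>auto intro!: AE_I2\<close>)
  then show ?thesis by (simp add: exp_reward_def mult.commute)
qed

section \<open>A priori bound from the optimality equation\<close>

text \<open>Let \<open>s\<close> be the supremum of the absolute value of \<open>v\<close>, finite
  since \<open>v\<close> is bounded. The fixed-point equation gives
  \<open>s \<le> C + disc M * s\<close>, which is solved for \<open>s\<close>.\<close>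

lemma bellman_fixpoint_bound:
  assumes \<gamma>: "\<gamma> \<in> params M"
    and v: "v \<in> borel_measurable SS" and bv: "bounded (v ` states M)"
    and adm: "\<And>x. x \<in> states M \<Longrightarrow> m x \<in> adm M x"
    and fp: "\<And>x. x \<in> states M \<Longrightarrow> v x = bellman_rhs M \<gamma> v x (m x)"
    and C: "\<And>x u. (x, u) \<in> adm_pairs M \<Longrightarrow> \<bar>exp_reward M \<gamma> x u\<bar> \<le> C"
  shows "x \<in> states M \<Longrightarrow> \<bar>v x\<bar> \<le> C / (1 - disc M)"
    and "(x, u) \<in> adm_pairs M \<Longrightarrow> \<bar>bellman_rhs M \<gamma> v x u\<bar> \<le> C / (1 - disc M)"
proof -
  have rhs: "\<bar>bellman_rhs M \<gamma> v x u\<bar> \<le> C + disc M * B"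
    if xu: "(x, u) \<in> adm_pairs M" and B: "\<And>y. y \<in> states M \<Longrightarrow> \<bar>v y\<bar> \<le> B" for x u B
  proof -
    have "\<bar>\<integral>y. v y \<partial>trans_law M \<gamma> x u\<bar> \<le> B"
      by (rule abs_integral_le_prob[OF prob_space_trans_law[OF \<gamma> xu]])
        (use v B in \<open>auto simp: measurable_cong_sets[OF sets_trans_law refl]\<close>)
    then have "disc M * \<bar>\<integral>y. v y \<partial>trans_law M \<gamma> x u\<bar> \<le> disc M * B"
      using disc_nonneg by (rule mult_left_mono)
    then have "\<bar>disc M * (\<integral>y. v y \<partial>trans_law M \<gamma> x u)\<bar> \<le> disc M * B"
      using disc_nonneg by (simp add: abs_mult)
    then show ?thesis using C[OF xu] unfolding bellman_rhs_def by linarith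
  qed
  have bound: "\<bar>v x\<bar> \<le> C / (1 - disc M)" if x: "x \<in> states M" for x
  proof -
    define s where "s = (SUP y\<in>states M. \<bar>v y\<bar>)"
    have bdd: "bdd_above ((\<lambda>y. \<bar>v y\<bar>) ` states M)"
      using bv by (auto simp: bounded_iff bdd_above_def)
    have le: "\<bar>v y\<bar> \<le> s" if "y \<in> states M" for y
      unfolding s_def by (rule cSUP_upper[OF that bdd])
    have "s \<le> C + disc M * s"
      unfolding s_def
    proof (rule cSUP_least)
      fix y assume y: "y \<in> states M"
      then show "\<bar>v y\<bar> \<le> C + disc M * (SUP y\<in>states M. \<bar>v y\<bar>)"
        using rhs[of y "m y" s] le fp[OF y] adm[OF y] by (auto simp: adm_pairs_iff s_def[symmetric])
    qed (use x in auto)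
    then have "s \<le> C / (1 - disc M)"
      using disc_less_1 by (simp add: pos_le_divide_eq algebra_simps)
    with le[OF x] show ?thesis by simp
  qed
  then show "x \<in> states M \<Longrightarrow> \<bar>v x\<bar> \<le> C / (1 - disc M)" .
  \<comment> \<open>The bound reproduces itself under one Bellman step, so it also holds for the
    right-hand side at controls that are not optimal.\<close>
  have "C + disc M * (C / (1 - disc M)) = C / (1 - disc M)"
    using disc_less_1 by (simp add: field_simps)
  then show "(x, u) \<in> adm_pairs M \<Longrightarrow> \<bar>bellman_rhs M \<gamma> v x u\<bar> \<le> C / (1 - disc M)"
    using rhs[of x u "C / (1 - disc M)"] bound by simp
qed

end

section \<open>Thompson sampling\<close>

text \<open>One initial state with its trajectory law. The constant \<open>c\<close> is a common
  positive lower bound of all densities: it keeps likelihoods positive and makes every set of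
  positive reference measure reachable with uniform weight. Separation of the parameters is recorded
  pair by pair.\<close>

locale thompson = controlled_model M
  for M :: "('x::polish_space, 'u::polish_space, 'p) model" +
  fixes \<mu> :: "'p \<Rightarrow> 'x \<Rightarrow> 'u" and \<theta> :: 'p and p0 :: "'p \<Rightarrow> real" and x0 :: 'x
    and P :: "(nat \<Rightarrow> ('x, 'u, 'p) ts_step) measure" and c :: real
  assumes \<theta> [measurable]: "\<theta> \<in> params M"
    and x0: "x0 \<in> states M"
    and \<mu>_meas: "\<And>\<gamma>. \<gamma> \<in> params M \<Longrightarrow> \<mu> \<gamma> \<in> SS \<rightarrow>\<^sub>M CS"
    and \<mu>_adm: "\<And>\<gamma> x. \<gamma> \<in> params M \<Longrightarrow> x \<in> states M \<Longrightarrow> \<mu> \<gamma> x \<in> adm M x"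
    and p0_pos: "\<And>\<gamma>. \<gamma> \<in> params M \<Longrightarrow> 0 < p0 \<gamma>"
    and law: "thompson_law M \<mu> p0 \<theta> x0 P"
    and c_pos: "0 < c"
    and rew_lower: "\<And>\<gamma> x u r. \<gamma> \<in> params M \<Longrightarrow> (x, u) \<in> adm_pairs M \<Longrightarrow> r \<in> rewards M
           \<Longrightarrow> c \<le> rew_dens M \<gamma> x u r"
    and trans_lower: "\<And>\<gamma> x u y. \<gamma> \<in> params M \<Longrightarrow> (x, u) \<in> adm_pairs M \<Longrightarrow> y \<in> states M
           \<Longrightarrow> c \<le> trans_dens M \<gamma> x u y"
    and separated: "\<And>\<gamma> x u. \<gamma> \<in> params M \<Longrightarrow> \<gamma> \<noteq> \<theta> \<Longrightarrow> (x, u) \<in> adm_pairs M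
           \<Longrightarrow> 0 < rel_entropy (joint_law M \<theta> x u) (joint_law M \<gamma> x u)"
begin

section \<open>Trajectories and their coordinates\<close>

abbreviation "HS t \<equiv> hist_space M S t"

lemma prob_space_P: "prob_space P"
  and sets_P [measurable_cong]: "sets P = sets (\<Pi>\<^sub>M t\<in>UNIV. S)"
  using law by (auto simp: thompson_law_def Let_def)

sublocale prob_space P by (rule prob_space_P)

lemma measurable_step [measurable]: "(\<lambda>\<omega>. \<omega> t) \<in> P \<rightarrow>\<^sub>M S"
  by measurable

lemma measurable_ts_state [measurable]: "ts_state t \<in> P \<rightarrow>\<^sub>M SS"
  and measurable_ts_param [measurable]: "ts_param t \<in> P \<rightarrow>\<^sub>M Pa"
  and measurable_ts_control [measurable]: "ts_control t \<in> P \<rightarrow>\<^sub>M CS"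
  and measurable_ts_reward [measurable]: "ts_reward t \<in> P \<rightarrow>\<^sub>M RS"
  unfolding ts_state_def[abs_def] ts_param_def[abs_def] ts_control_def[abs_def] ts_reward_def[abs_def]
  by (rule measurable_compose[OF measurable_step], simp add: ts_step_space_def)+

lemma measurable_hist [measurable]: "hist t \<in> P \<rightarrow>\<^sub>M HS t"
proof -
  have "(\<lambda>\<omega>. restrict \<omega> {..<t}) \<in> P \<rightarrow>\<^sub>M (\<Pi>\<^sub>M i\<in>{..<t}. S)"
    by (subst measurable_cong_sets[OF sets_P refl]) (rule measurable_restrict_subset, simp)
  moreover have "(\<lambda>\<omega>. fst (\<omega> t)) \<in> P \<rightarrow>\<^sub>M SS"
    using measurable_ts_state[of t] by (simp add: ts_state_def[abs_def])
  ultimately show ?thesis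
    unfolding hist_def[abs_def] hist_space_def by (rule measurable_Pair)
qed

lemma snd_hist [simp]: "snd (hist t \<omega>) = ts_state t \<omega>"
  by (simp add: hist_def ts_state_def)

lemma measurable_snd_hist [measurable]: "snd \<in> HS t \<rightarrow>\<^sub>M SS"
  by (simp add: hist_space_def)

lemma in_space:
  assumes "\<omega> \<in> space P"
  shows "ts_state t \<omega> \<in> states M" "ts_param t \<omega> \<in> params M" "ts_reward t \<omega> \<in> rewards M"
  using measurable_space[OF measurable_ts_state assms] measurable_space[OF measurable_ts_param assms]
    measurable_space[OF measurable_ts_reward assms] by auto

lemma AE_control: "AE \<omega> in P. ts_control t \<omega> = \<mu> (ts_param t \<omega>) (ts_state t \<omega>)"
  using law by (auto simp: thompson_law_def Let_def)

text \<open>Controls agree with the sampled policies only almost surely, for each time separately.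
  Collecting all times in one event of probability 1 lets later identities be checked trajectory by
  trajectory.\<close>

definition good :: "(nat \<Rightarrow> ('x, 'u, 'p) ts_step) \<Rightarrow> bool" where
  "good \<omega> \<longleftrightarrow> (\<forall>t. ts_state t \<omega> \<in> states M \<and> ts_param t \<omega> \<in> params M \<and> ts_reward t \<omega> \<in> rewards M
     \<and> ts_control t \<omega> = \<mu> (ts_param t \<omega>) (ts_state t \<omega>))"

lemma AE_good: "AE \<omega> in P. good \<omega>"
proof -
  have "AE \<omega> in P. \<forall>t. ts_control t \<omega> = \<mu> (ts_param t \<omega>) (ts_state t \<omega>)"
    by (subst AE_all_countable) (use AE_control in blast)
  with AE_space show ?thesis
    by eventually_elim (simp add: good_def in_space)
qed

lemma good_adm: "good \<omega> \<Longrightarrow> (ts_state t \<omega>, ts_control t \<omega>) \<in> adm_pairs M"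
  by (auto simp: good_def adm_pairs_iff \<mu>_adm)

lemma cond_law_reward:
  "cond_law P (\<lambda>\<omega>. (hist t \<omega>, ts_param t \<omega>, ts_control t \<omega>)) (HS t \<Otimes>\<^sub>M (Pa \<Otimes>\<^sub>M CS)) (ts_reward t) RS
     (\<lambda>z. density \<Lambda> (\<lambda>r. ennreal (rew_dens M \<theta> (snd (fst z)) (snd (snd z)) r)))"
  using law by (auto simp: thompson_law_def Let_def reward_law_def split_def)

lemma cond_law_trans:
  "cond_law P (\<lambda>\<omega>. (hist t \<omega>, ts_param t \<omega>, ts_control t \<omega>, ts_reward t \<omega>))
     (HS t \<Otimes>\<^sub>M (Pa \<Otimes>\<^sub>M (CS \<Otimes>\<^sub>M RS))) (ts_state (Suc t)) SS
     (\<lambda>z. density H (\<lambda>y. ennreal (trans_dens M \<theta> (snd (fst z)) (fst (snd (snd z))) y)))"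
  using law by (auto simp: thompson_law_def Let_def trans_law_def split_def)

section \<open>One step of the trajectory and the square-root likelihood ratio\<close>

text \<open>The tower property applied twice: integrate out the next state, then the reward. Both
  conditional densities under \<theta> depend only on the current state and control, so together
  they form \<open>pair_dens\<close>, and the factor \<open>G\<close> of the history comes
  out.\<close>

lemma nn_integral_step:
  assumes G [measurable]: "G \<in> borel_measurable (HS t)"
    and \<phi> [measurable]: "\<phi> \<in> borel_measurable ((SS \<Otimes>\<^sub>M CS) \<Otimes>\<^sub>M (RS \<Otimes>\<^sub>M SS))"
  shows "(\<integral>\<^sup>+\<omega>. G (hist t \<omega>)
            * \<phi> ((ts_state t \<omega>, ts_control t \<omega>), (ts_reward t \<omega>, ts_state (Suc t) \<omega>)) \<partial>P)
       = (\<integral>\<^sup>+\<omega>. G (hist t \<omega>)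
            * (\<integral>\<^sup>+z. ennreal (pair_dens M \<theta> (ts_state t \<omega>) (ts_control t \<omega>) z)
                  * \<phi> ((ts_state t \<omega>, ts_control t \<omega>), z) \<partial>(\<Lambda> \<Otimes>\<^sub>M H)) \<partial>P)"
proof -
  let ?X = "ts_state t" and ?U = "ts_control t" and ?R = "ts_reward t"
  let ?q = "\<lambda>x u y. ennreal (trans_dens M \<theta> x u y)" and ?f = "\<lambda>x u r. ennreal (rew_dens M \<theta> x u r)"
  \<comment> \<open>The next state is integrated out, conditioning on everything up to the
    reward.\<close>
  have "(\<integral>\<^sup>+\<omega>. G (hist t \<omega>) * \<phi> ((?X \<omega>, ?U \<omega>), (?R \<omega>, ts_state (Suc t) \<omega>)) \<partial>P)
      = (\<integral>\<^sup>+\<omega>. (\<integral>\<^sup>+y. ?q (?X \<omega>) (?U \<omega>) y * (G (hist t \<omega>) * \<phi> ((?X \<omega>, ?U \<omega>), (?R \<omega>, y))) \<partial>H) \<partial>P)"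
    using cond_law_density_nn_integral[where P = P and \<eta> = H
        and Z = "\<lambda>\<omega>. (hist t \<omega>, ts_param t \<omega>, ?U \<omega>, ?R \<omega>)" and S = "HS t \<Otimes>\<^sub>M (Pa \<Otimes>\<^sub>M (CS \<Otimes>\<^sub>M RS))"
        and Y = "ts_state (Suc t)" and T = SS
        and k = "\<lambda>p. ?q (snd (fst (fst p))) (fst (snd (snd (fst p)))) (snd p)"
        and g = "\<lambda>p. G (fst (fst p))
           * \<phi> ((snd (fst (fst p)), fst (snd (snd (fst p)))), (snd (snd (snd (fst p))), snd p))",
        OF prob_space_P _ _ st.sigma_finite_measure_axioms sets_state_ref]
    using cond_law_trans[of t] by simp
  \<comment> \<open>Now the reward, conditioning on history, sampled parameter and control; the test
    function is the inner integral just obtained.\<close>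
  also have "\<dots> = (\<integral>\<^sup>+\<omega>. (\<integral>\<^sup>+r. ?f (?X \<omega>) (?U \<omega>) r
       * (\<integral>\<^sup>+y. ?q (?X \<omega>) (?U \<omega>) y * (G (hist t \<omega>) * \<phi> ((?X \<omega>, ?U \<omega>), (r, y))) \<partial>H) \<partial>\<Lambda>) \<partial>P)"
    using cond_law_density_nn_integral[where P = P and \<eta> = \<Lambda>
        and Z = "\<lambda>\<omega>. (hist t \<omega>, ts_param t \<omega>, ?U \<omega>)" and S = "HS t \<Otimes>\<^sub>M (Pa \<Otimes>\<^sub>M CS)"
        and Y = "?R" and T = RS
        and k = "\<lambda>p. ?f (snd (fst (fst p))) (snd (snd (fst p))) (snd p)"
        and g = "\<lambda>p. (\<integral>\<^sup>+y. ?q (snd (fst (fst p))) (snd (snd (fst p))) y * (G (fst (fst p))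
           * \<phi> ((snd (fst (fst p)), snd (snd (fst p))), (snd p, y))) \<partial>H)",
        OF prob_space_P _ _ rew.sigma_finite_measure_axioms sets_rew_ref]
    using cond_law_reward[of t] by simp
  \<comment> \<open>Tonelli merges the two integrals. \<open>ennreal\<close> is multiplicative here
    only for nonnegative densities, known at admissible pairs, hence the restriction to
    \<open>good\<close> trajectories.\<close>
  also have "\<dots> = (\<integral>\<^sup>+\<omega>. G (hist t \<omega>)
            * (\<integral>\<^sup>+z. ennreal (pair_dens M \<theta> (ts_state t \<omega>) (ts_control t \<omega>) z)
                  * \<phi> ((ts_state t \<omega>, ts_control t \<omega>), z) \<partial>(\<Lambda> \<Otimes>\<^sub>M H)) \<partial>P)"
  proof (rule nn_integral_cong_AE, use AE_good AE_space in eventually_elim)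
    fix \<omega> assume "good \<omega>" and w: "\<omega> \<in> space P"
    from good_adm[OF this(1)] have adm: "(?X \<omega>, ?U \<omega>) \<in> adm_pairs M" .
    have [measurable]: "?X \<omega> \<in> space SS" "?U \<omega> \<in> space CS" "hist t \<omega> \<in> space (HS t)"
      using w measurable_space[OF measurable_hist] measurable_space[OF measurable_ts_state]
       measurable_space[OF measurable_ts_control] by blast+
    have "(\<integral>\<^sup>+r. ?f (?X \<omega>) (?U \<omega>) r
       * (\<integral>\<^sup>+y. ?q (?X \<omega>) (?U \<omega>) y * (G (hist t \<omega>) * \<phi> ((?X \<omega>, ?U \<omega>), (r, y))) \<partial>H) \<partial>\<Lambda>)
      = (\<integral>\<^sup>+r. (\<integral>\<^sup>+y. ?f (?X \<omega>) (?U \<omega>) r * (?q (?X \<omega>) (?U \<omega>) y * (G (hist t \<omega>) * \<phi> ((?X \<omega>, ?U \<omega>), (r, y)))) \<partial>H) \<partial>\<Lambda>)"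
      by (intro nn_integral_cong nn_integral_cmult[symmetric]) measurable
    also have "\<dots> = (\<integral>\<^sup>+r. (\<integral>\<^sup>+y. G (hist t \<omega>) * (ennreal (pair_dens M \<theta> (?X \<omega>) (?U \<omega>) (r, y))
          * \<phi> ((?X \<omega>, ?U \<omega>), (r, y))) \<partial>H) \<partial>\<Lambda>)"
      by (intro nn_integral_cong)
        (use dens_nonneg[OF \<theta> adm] in \<open>simp add: pair_dens_def ennreal_mult ac_simps\<close>)
    also have "\<dots> = (\<integral>\<^sup>+z. G (hist t \<omega>) * (ennreal (pair_dens M \<theta> (?X \<omega>) (?U \<omega>) z)
          * \<phi> ((?X \<omega>, ?U \<omega>), z)) \<partial>(\<Lambda> \<Otimes>\<^sub>M H))"
      by (rule st.nn_integral_fst) measurable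
    also have "\<dots> = G (hist t \<omega>) * (\<integral>\<^sup>+z. ennreal (pair_dens M \<theta> (?X \<omega>) (?U \<omega>) z)
          * \<phi> ((?X \<omega>, ?U \<omega>), z) \<partial>(\<Lambda> \<Otimes>\<^sub>M H))"
      by (rule nn_integral_cmult) measurable
    finally show "(\<integral>\<^sup>+r. ?f (?X \<omega>) (?U \<omega>) r
       * (\<integral>\<^sup>+y. ?q (?X \<omega>) (?U \<omega>) y * (G (hist t \<omega>) * \<phi> ((?X \<omega>, ?U \<omega>), (r, y))) \<partial>H) \<partial>\<Lambda>)
      = G (hist t \<omega>) * (\<integral>\<^sup>+z. ennreal (pair_dens M \<theta> (?X \<omega>) (?U \<omega>) z)
          * \<phi> ((?X \<omega>, ?U \<omega>), z) \<partial>(\<Lambda> \<Otimes>\<^sub>M H))" .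
  qed
  finally show ?thesis .
qed

lemma pair_dens_lower:
  assumes "\<gamma> \<in> params M" "(x, u) \<in> adm_pairs M" "z \<in> rewards M \<times> states M"
  shows "c * c \<le> pair_dens M \<gamma> x u z"
  using rew_lower[OF assms(1,2)] trans_lower[OF assms(1,2)] assms(3) c_pos
  by (auto simp: pair_dens_def intro!: mult_mono order_trans[OF less_imp_le[OF c_pos]])

lemma pair_dens_pos:
  assumes "\<gamma> \<in> params M" "(x, u) \<in> adm_pairs M" "z \<in> rewards M \<times> states M"
  shows "0 < pair_dens M \<gamma> x u z"
  using pair_dens_lower[OF assms] c_pos mult_pos_pos[OF c_pos c_pos] by linarith

lemma likelihood_pos:
  assumes "\<gamma> \<in> params M" "good \<omega>"
  shows "0 < likelihood M \<gamma> t (hist t \<omega>)"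
proof (induction t)
  case (Suc t)
  have "(ts_reward t \<omega>, ts_state (Suc t) \<omega>) \<in> rewards M \<times> states M"
    using assms(2) by (simp add: good_def)
  then show ?case
    using Suc pair_dens_pos[OF assms(1) good_adm[OF assms(2)]] by (simp add: likelihood_Suc)
qed (simp add: likelihood_0)

lemma sqrt_ratio_Suc:
  assumes "\<gamma> \<in> params M" "good \<omega>"
  shows "ennreal (sqrt_ratio M \<theta> \<gamma> (Suc t) (hist (Suc t) \<omega>)) = ennreal (sqrt_ratio M \<theta> \<gamma> t (hist t \<omega>))
    * ennreal (sqrt (pair_dens M \<gamma> (ts_state t \<omega>) (ts_control t \<omega>) (ts_reward t \<omega>, ts_state (Suc t) \<omega>)
        / pair_dens M \<theta> (ts_state t \<omega>) (ts_control t \<omega>) (ts_reward t \<omega>, ts_state (Suc t) \<omega>)))"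
proof -
  have "0 \<le> sqrt_ratio M \<theta> \<gamma> t (hist t \<omega>)"
    using likelihood_pos[OF assms, of t] likelihood_pos[OF \<theta> assms(2), of t] by (simp add: sqrt_ratio_def)
  then show ?thesis
    by (simp add: ennreal_mult'[symmetric] sqrt_ratio_def likelihood_Suc real_sqrt_mult real_sqrt_divide)
qed

lemma measurable_sqrt_ratio [measurable]:
  assumes [measurable]: "\<gamma> \<in> params M"
  shows "sqrt_ratio M \<theta> \<gamma> t \<in> borel_measurable (HS t)"
proof -
  note [measurable] = measurable_likelihood[OF assms] measurable_likelihood[OF \<theta>]
  show ?thesis unfolding sqrt_ratio_def[abs_def] by measurable
qed

text \<open>The new factor of the ratio, integrated against the density of the true parameter,
  becomes the integrand of the affinity. The weight \<open>F\<close> on the next state allows two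
  such steps to be chained; \<open>F = 1\<close> gives the affinity itself.\<close>

lemma nn_integral_sqrt_ratio_Suc:
  assumes g [measurable]: "\<gamma> \<in> params M" and F [measurable]: "F \<in> borel_measurable SS"
  shows "(\<integral>\<^sup>+\<omega>. ennreal (sqrt_ratio M \<theta> \<gamma> (Suc t) (hist (Suc t) \<omega>)) * F (ts_state (Suc t) \<omega>) \<partial>P)
    = (\<integral>\<^sup>+\<omega>. ennreal (sqrt_ratio M \<theta> \<gamma> t (hist t \<omega>))
        * (\<integral>\<^sup>+z. ennreal (sqrt (pair_dens M \<theta> (ts_state t \<omega>) (ts_control t \<omega>) z
               * pair_dens M \<gamma> (ts_state t \<omega>) (ts_control t \<omega>) z)) * F (snd z) \<partial>(\<Lambda> \<Otimes>\<^sub>M H)) \<partial>P)"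
proof -
  let ?\<phi> = "\<lambda>p. ennreal (sqrt (pair_dens M \<gamma> (fst (fst p)) (snd (fst p)) (snd p)
       / pair_dens M \<theta> (fst (fst p)) (snd (fst p)) (snd p))) * F (snd (snd p))"
  have "(\<integral>\<^sup>+\<omega>. ennreal (sqrt_ratio M \<theta> \<gamma> (Suc t) (hist (Suc t) \<omega>)) * F (ts_state (Suc t) \<omega>) \<partial>P)
    = (\<integral>\<^sup>+\<omega>. ennreal (sqrt_ratio M \<theta> \<gamma> t (hist t \<omega>))
        * ?\<phi> ((ts_state t \<omega>, ts_control t \<omega>), (ts_reward t \<omega>, ts_state (Suc t) \<omega>)) \<partial>P)"
    by (rule nn_integral_cong_AE, use AE_good in eventually_elim) (simp add: sqrt_ratio_Suc[OF g] ac_simps)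
  also have "\<dots> = (\<integral>\<^sup>+\<omega>. ennreal (sqrt_ratio M \<theta> \<gamma> t (hist t \<omega>))
        * (\<integral>\<^sup>+z. ennreal (pair_dens M \<theta> (ts_state t \<omega>) (ts_control t \<omega>) z)
             * ?\<phi> ((ts_state t \<omega>, ts_control t \<omega>), z) \<partial>(\<Lambda> \<Otimes>\<^sub>M H)) \<partial>P)"
    by (rule nn_integral_step) measurable
  also have "\<dots> = (\<integral>\<^sup>+\<omega>. ennreal (sqrt_ratio M \<theta> \<gamma> t (hist t \<omega>))
        * (\<integral>\<^sup>+z. ennreal (sqrt (pair_dens M \<theta> (ts_state t \<omega>) (ts_control t \<omega>) z
               * pair_dens M \<gamma> (ts_state t \<omega>) (ts_control t \<omega>) z)) * F (snd z) \<partial>(\<Lambda> \<Otimes>\<^sub>M H)) \<partial>P)"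
  proof (rule nn_integral_cong_AE, use AE_good in eventually_elim,
      rule arg_cong2[where f = "(*)"], rule refl, rule nn_integral_cong)
    fix \<omega> z assume w: "good \<omega>" and "z \<in> space (\<Lambda> \<Otimes>\<^sub>M H)"
    then have z: "z \<in> rewards M \<times> states M" by (simp add: space_pair_measure)
    define a b where "a = pair_dens M \<theta> (ts_state t \<omega>) (ts_control t \<omega>) z"
      and "b = pair_dens M \<gamma> (ts_state t \<omega>) (ts_control t \<omega>) z"
    have "0 < a" "0 < b"
      unfolding a_def b_def using pair_dens_pos[OF \<theta> good_adm[OF w] z] pair_dens_pos[OF g good_adm[OF w] z]
      by auto
    \<comment> \<open>Positivity of \<open>a\<close>, the density under \<theta>, is what permits
      the cancellation.\<close>
    then have "a * sqrt (b / a) = sqrt (a * b)"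
      using real_div_sqrt[of a] by (simp add: real_sqrt_mult real_sqrt_divide flip: times_divide_eq_left)
    then have "ennreal a * ennreal (sqrt (b / a)) = ennreal (sqrt (a * b))"
      using \<open>0 < a\<close> by (simp add: ennreal_mult'[symmetric])
    then show "ennreal (pair_dens M \<theta> (ts_state t \<omega>) (ts_control t \<omega>) z)
        * ?\<phi> ((ts_state t \<omega>, ts_control t \<omega>), z)
      = ennreal (sqrt (pair_dens M \<theta> (ts_state t \<omega>) (ts_control t \<omega>) z
               * pair_dens M \<gamma> (ts_state t \<omega>) (ts_control t \<omega>) z)) * F (snd z)"
      by (simp add: a_def b_def mult.assoc[symmetric])
  qed
  finally show ?thesis .
qed

section \<open>Geometric decay of the mean square-root ratio\<close>

text \<open>A density over a null space would integrate to 0 instead of 1; \<open>x0\<close> with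
  its optimal control supplies an admissible pair.\<close>

lemma emeasure_space_pos: "0 < emeasure \<Lambda> (rewards M)" "0 < emeasure H (states M)"
proof -
  have adm: "(x0, \<mu> \<theta> x0) \<in> adm_pairs M" using x0 \<theta> \<mu>_adm by (simp add: adm_pairs_iff)
  have "emeasure \<Lambda> (rewards M) \<noteq> 0"
  proof
    assume "emeasure \<Lambda> (rewards M) = 0"
    then have "(\<integral>\<^sup>+ r. ennreal (rew_dens M \<theta> x0 (\<mu> \<theta> x0) r) \<partial>\<Lambda>) = (\<integral>\<^sup>+ r. 0 \<partial>\<Lambda>)"
      by (intro nn_integral_cong_AE AE_I[where N = "space \<Lambda>"]) (use sets.top[of \<Lambda>] in auto)
    then show False using nn_integral_dens(1)[OF \<theta> adm] by simp
  qed
  then show "0 < emeasure \<Lambda> (rewards M)" by (simp add: zero_less_iff_neq_zero)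
  have "emeasure H (states M) \<noteq> 0"
  proof
    assume "emeasure H (states M) = 0"
    then have "(\<integral>\<^sup>+ y. ennreal (trans_dens M \<theta> x0 (\<mu> \<theta> x0) y) \<partial>H) = (\<integral>\<^sup>+ y. 0 \<partial>H)"
      by (intro nn_integral_cong_AE AE_I[where N = "space H"]) (use sets.top[of H] in auto)
    then show False using nn_integral_dens(2)[OF \<theta> adm] by simp
  qed
  then show "0 < emeasure H (states M)" by (simp add: zero_less_iff_neq_zero)
qed

text \<open>At a fixed state only finitely many affinities occur, one for each sampled parameter and
  each wrong one, and all are below 1. Hence each state lies in some \<open>A n\<close>, where the
  gap is at least \<open>1 / (n + 1)\<close>. These countably many sets cover a space of positive
  measure, so one of them is not null.\<close>

lemma ex_informative_set:
  obtains A d where "A \<in> sets SS" "0 < d" "d \<le> (1::real)" "0 < emeasure H A"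
    "\<And>y \<gamma>' \<gamma>. y \<in> A \<Longrightarrow> \<gamma>' \<in> params M \<Longrightarrow> \<gamma> \<in> params M \<Longrightarrow> \<gamma> \<noteq> \<theta>
       \<Longrightarrow> affinity M \<theta> \<gamma> y (\<mu> \<gamma>' y) \<le> ennreal (1 - d)"
proof -
  define A where "A n = {y \<in> space SS. \<forall>\<gamma>'\<in>params M. \<forall>\<gamma>\<in>params M - {\<theta>}.
     affinity M \<theta> \<gamma> y (\<mu> \<gamma>' y) \<le> ennreal (1 - inverse (of_nat (Suc n)))}" for n
  have A_sets: "A n \<in> sets SS" for n
    unfolding A_def
  proof (intro sets.sets_Collect_finite_All finite_params finite_Diff)
    fix \<gamma>' \<gamma> assume *: "\<gamma>' \<in> params M" "\<gamma> \<in> params M - {\<theta>}"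
    then have [measurable]: "\<mu> \<gamma>' \<in> SS \<rightarrow>\<^sub>M CS" "\<gamma> \<in> params M" by (auto intro: \<mu>_meas)
    show "{y \<in> space SS. affinity M \<theta> \<gamma> y (\<mu> \<gamma>' y) \<le> ennreal (1 - inverse (of_nat (Suc n)))} \<in> sets SS"
      by measurable
  qed
  have "\<exists>n. y \<in> A n" if y: "y \<in> states M" for y
  proof -
    \<comment> \<open>Inserting 0 keeps the maximum defined when \<theta> is the only
      parameter.\<close>
    define m where "m = Max (insert 0 ((\<lambda>(\<gamma>', \<gamma>). affinity M \<theta> \<gamma> y (\<mu> \<gamma>' y)) ` (params M \<times> (params M - {\<theta>}))))"
    have fin: "finite (insert 0 ((\<lambda>(\<gamma>', \<gamma>). affinity M \<theta> \<gamma> y (\<mu> \<gamma>' y)) ` (params M \<times> (params M - {\<theta>}))))"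
      using finite_params by simp
    have "affinity M \<theta> \<gamma> y (\<mu> \<gamma>' y) < 1" if "\<gamma>' \<in> params M" "\<gamma> \<in> params M" "\<gamma> \<noteq> \<theta>" for \<gamma>' \<gamma>
      using y that by (intro affinity_less_1 separated \<theta>) (auto simp: adm_pairs_iff \<mu>_adm)
    then have "m < 1"
      unfolding m_def Max_less_iff[OF fin insert_not_empty] by auto
    then obtain r where r: "m = ennreal r" "0 \<le> r" "r < 1"
      by (cases m) (auto simp: ennreal_less_one_iff)
    then obtain n where "inverse (of_nat (Suc n)) < 1 - r"
      using reals_Archimedean[of "1 - r"] by auto
    then have "m \<le> ennreal (1 - inverse (of_nat (Suc n)))"
      unfolding r(1) by (intro ennreal_leI) linarith
    moreover have "affinity M \<theta> \<gamma> y (\<mu> \<gamma>' y) \<le> m" if "\<gamma>' \<in> params M" "\<gamma> \<in> params M - {\<theta>}" for \<gamma>' \<gamma>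
      unfolding m_def by (rule Max_ge[OF fin]) (use that in force)
    ultimately show ?thesis using y unfolding A_def by (auto intro: order_trans)
  qed
  then have U: "(\<Union>n. A n) = states M" by (auto simp: A_def)
  have "\<exists>n. emeasure H (A n) \<noteq> 0"
  proof (rule ccontr)
    assume "\<not> ?thesis"
    then have "emeasure H (\<Union>n. A n) = 0"
      by (intro emeasure_UN_eq_0) (auto simp: A_sets sets_state_ref)
    then show False using emeasure_space_pos(2) U by simp
  qed
  then obtain n where "0 < emeasure H (A n)" by (auto simp: zero_less_iff_neq_zero)
  moreover have "inverse (real (Suc n)) \<le> 1"
    by (simp add: inverse_le_1_iff)
  ultimately show thesis
    by (intro that[of "A n" "inverse (real (Suc n))"] A_sets) (auto simp: A_def)
qed

text \<open>The densities need not be bounded above, so the affinity may be arbitrarily close to 1 in spite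
  of the uniform lower bound on the relative entropy. But the transition densities are bounded below,
  so every second step leads into the set of \<open>ex_informative_set\<close> with positive weight.\<close>

lemma two_step_contraction:
  obtains \<rho> :: real where "0 < \<rho>" "\<rho> < 1"
    "\<And>\<gamma> t. \<gamma> \<in> params M \<Longrightarrow> \<gamma> \<noteq> \<theta> \<Longrightarrow>
      (\<integral>\<^sup>+\<omega>. ennreal (sqrt_ratio M \<theta> \<gamma> (Suc (Suc t)) (hist (Suc (Suc t)) \<omega>)) \<partial>P)
        \<le> ennreal \<rho> * (\<integral>\<^sup>+\<omega>. ennreal (sqrt_ratio M \<theta> \<gamma> t (hist t \<omega>)) \<partial>P)"
proof -
  obtain A d where A: "A \<in> sets SS" and d: "0 < d" "d \<le> (1::real)" and A_pos: "0 < emeasure H A"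
    and A_aff: "\<And>y \<gamma>' \<gamma>. y \<in> A \<Longrightarrow> \<gamma>' \<in> params M \<Longrightarrow> \<gamma> \<in> params M \<Longrightarrow> \<gamma> \<noteq> \<theta>
       \<Longrightarrow> affinity M \<theta> \<gamma> y (\<mu> \<gamma>' y) \<le> ennreal (1 - d)"
    by (rule ex_informative_set) blast
  note [measurable] = A
  \<comment> \<open>A bound for the affinity one step later that depends on the state alone: on
    \<open>A\<close> the gap \<open>d\<close> holds for every control Thompson sampling can choose
    there.\<close>
  define F where "F y = (if y \<in> A then ennreal (1 - d) else 1)" for y
  have F_meas [measurable]: "F \<in> borel_measurable SS"
    unfolding F_def by measurable
  define s where "s \<gamma> x u z = ennreal (sqrt (pair_dens M \<theta> x u z * pair_dens M \<gamma> x u z))" for \<gamma> x u z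
  \<comment> \<open>Guaranteed loss over two steps: the affinity integrand is at least
    \<open>c * c\<close>, being the geometric mean of two densities bounded below by
    \<open>c * c\<close>, and on \<open>A\<close> a fraction \<open>d\<close> of it is
    removed.\<close>
  define E where "E = ennreal (c * c * d) * emeasure (\<Lambda> \<Otimes>\<^sub>M H) (rewards M \<times> A)"
  have "emeasure (\<Lambda> \<Otimes>\<^sub>M H) (rewards M \<times> A) = emeasure \<Lambda> (rewards M) * emeasure H A"
    by (rule st.emeasure_pair_measure_Times) (use sets.top[of \<Lambda>] A sets_state_ref in auto)
  then have E_pos: "0 < E"
    using A_pos emeasure_space_pos(1) d c_pos by (simp add: E_def ennreal_zero_less_mult_iff)
  \<comment> \<open>Since \<open>F + d * indicator A = 1\<close>, the integral with weight
    \<open>F\<close> and the removed part add up to the affinity, which is at most 1; the removed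
    part is at least \<open>E\<close>.\<close>
  have sF: "(\<integral>\<^sup>+z. s \<gamma> x u z * F (snd z) \<partial>(\<Lambda> \<Otimes>\<^sub>M H)) + E \<le> 1"
    if g [measurable]: "\<gamma> \<in> params M" and xu: "(x, u) \<in> adm_pairs M" for \<gamma> x u
  proof -
    have [measurable]: "x \<in> space SS" "u \<in> space CS"
      using xu by (auto simp: adm_pairs_iff intro: adm_in_controls)
    have s_meas [measurable]: "s \<gamma> x u \<in> borel_measurable (\<Lambda> \<Otimes>\<^sub>M H)"
      unfolding s_def by measurable
    have "E = (\<integral>\<^sup>+z. ennreal (c * c * d) * indicator (rewards M \<times> A) z \<partial>(\<Lambda> \<Otimes>\<^sub>M H))"
      unfolding E_def using sets.top[of \<Lambda>] A
      by (intro nn_integral_cmult_indicator[symmetric]) (auto simp: sets_state_ref)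
    also have "\<dots> \<le> (\<integral>\<^sup>+z. s \<gamma> x u z * (ennreal d * indicator A (snd z)) \<partial>(\<Lambda> \<Otimes>\<^sub>M H))"
    proof (intro nn_integral_mono)
      fix z assume "z \<in> space (\<Lambda> \<Otimes>\<^sub>M H)"
      then have z: "z \<in> rewards M \<times> states M" by (simp add: space_pair_measure)
      have "c * c \<le> sqrt (pair_dens M \<theta> x u z * pair_dens M \<gamma> x u z)"
      proof (rule real_le_rsqrt)
        show "(c * c)\<^sup>2 \<le> pair_dens M \<theta> x u z * pair_dens M \<gamma> x u z"
          unfolding power2_eq_square using pair_dens_lower[OF \<theta> xu z] pair_dens_lower[OF g xu z] c_pos
          by (intro mult_mono) (auto intro: less_imp_le order_trans[OF _ pair_dens_lower[OF \<theta> xu z]])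
      qed
      then have "ennreal (c * c) * ennreal d \<le> s \<gamma> x u z * ennreal d"
        unfolding s_def by (intro mult_right_mono ennreal_leI) auto
      then show "ennreal (c * c * d) * indicator (rewards M \<times> A) z
         \<le> s \<gamma> x u z * (ennreal d * indicator A (snd z))"
        using z d c_pos by (auto simp: ennreal_mult indicator_def)
    qed
    finally have "(\<integral>\<^sup>+z. s \<gamma> x u z * F (snd z) \<partial>(\<Lambda> \<Otimes>\<^sub>M H)) + E
      \<le> (\<integral>\<^sup>+z. s \<gamma> x u z * F (snd z) \<partial>(\<Lambda> \<Otimes>\<^sub>M H))
        + (\<integral>\<^sup>+z. s \<gamma> x u z * (ennreal d * indicator A (snd z)) \<partial>(\<Lambda> \<Otimes>\<^sub>M H))"
      by (rule add_left_mono)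
    also have "\<dots> = (\<integral>\<^sup>+z. s \<gamma> x u z * F (snd z) + s \<gamma> x u z * (ennreal d * indicator A (snd z)) \<partial>(\<Lambda> \<Otimes>\<^sub>M H))"
      by (rule nn_integral_add[symmetric]) measurable
    also have "\<dots> = (\<integral>\<^sup>+z. s \<gamma> x u z \<partial>(\<Lambda> \<Otimes>\<^sub>M H))"
    proof (intro nn_integral_cong)
      fix z :: "real \<times> 'x"
      have "F (snd z) + ennreal d * indicator A (snd z) = 1"
        using d ennreal_plus[of "1 - d" d] by (auto simp: F_def)
      then show "s \<gamma> x u z * F (snd z) + s \<gamma> x u z * (ennreal d * indicator A (snd z)) = s \<gamma> x u z"
        by (simp flip: distrib_left)
    qed
    also have "\<dots> \<le> 1"
      using affinity_le_1[OF \<theta> g xu] by (simp add: affinity_def s_def)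
    finally show ?thesis .
  qed
  have adm: "(x0, \<mu> \<theta> x0) \<in> adm_pairs M" using x0 \<theta> \<mu>_adm by (simp add: adm_pairs_iff)
  \<comment> \<open>A single admissible pair shows that \<open>E\<close> is finite, so that
    subtraction can take place in the reals.\<close>
  have "E \<le> 1"
    using sF[OF \<theta> adm] by (rule order_trans[rotated]) (simp add: add_increasing)
  then obtain e where e: "E = ennreal e" "0 \<le> e" by (cases E) (auto simp: top_unique)
  with E_pos have "0 < e" by simp
  \<comment> \<open>The maximum with \<open>1 / 2\<close> keeps \<rho> positive even if
    \<open>e = 1\<close>; later there is a division by its square root.\<close>
  define \<rho> where "\<rho> = max (1 - e) (1 / 2)"
  have sF': "(\<integral>\<^sup>+z. s \<gamma> x u z * F (snd z) \<partial>(\<Lambda> \<Otimes>\<^sub>M H)) \<le> ennreal \<rho>"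
    if gxu: "\<gamma> \<in> params M" "(x, u) \<in> adm_pairs M" for \<gamma> x u
  proof -
    obtain i where i: "(\<integral>\<^sup>+z. s \<gamma> x u z * F (snd z) \<partial>(\<Lambda> \<Otimes>\<^sub>M H)) = ennreal i" "0 \<le> i"
      using sF[OF gxu] by (cases "\<integral>\<^sup>+z. s \<gamma> x u z * F (snd z) \<partial>(\<Lambda> \<Otimes>\<^sub>M H)") (auto simp: top_unique)
    then have "ennreal (i + e) \<le> 1" using sF[OF gxu] e by simp
    then have "i \<le> 1 - e" using i e by (simp del: ennreal_plus)
    then show ?thesis unfolding i by (intro ennreal_leI) (simp add: \<rho>_def)
  qed
  have "(\<integral>\<^sup>+\<omega>. ennreal (sqrt_ratio M \<theta> \<gamma> (Suc (Suc t)) (hist (Suc (Suc t)) \<omega>)) \<partial>P)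
        \<le> ennreal \<rho> * (\<integral>\<^sup>+\<omega>. ennreal (sqrt_ratio M \<theta> \<gamma> t (hist t \<omega>)) \<partial>P)"
    if g [measurable]: "\<gamma> \<in> params M" and ne: "\<gamma> \<noteq> \<theta>" for \<gamma> t
  proof -
    have "(\<integral>\<^sup>+\<omega>. ennreal (sqrt_ratio M \<theta> \<gamma> (Suc (Suc t)) (hist (Suc (Suc t)) \<omega>)) \<partial>P)
      = (\<integral>\<^sup>+\<omega>. ennreal (sqrt_ratio M \<theta> \<gamma> (Suc t) (hist (Suc t) \<omega>))
           * affinity M \<theta> \<gamma> (ts_state (Suc t) \<omega>) (ts_control (Suc t) \<omega>) \<partial>P)"
      using nn_integral_sqrt_ratio_Suc[OF g, of "\<lambda>_. 1" "Suc t"] by (simp add: affinity_def)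
    \<comment> \<open>On \<open>A\<close> the control is the one prescribed by the sampled
      parameter, so the gap applies; off \<open>A\<close> the trivial bound 1 suffices.\<close>
    also have "\<dots> \<le> (\<integral>\<^sup>+\<omega>. ennreal (sqrt_ratio M \<theta> \<gamma> (Suc t) (hist (Suc t) \<omega>)) * F (ts_state (Suc t) \<omega>) \<partial>P)"
    proof (rule nn_integral_mono_AE, use AE_good in eventually_elim, rule mult_left_mono)
      fix \<omega> assume w: "good \<omega>"
      show "affinity M \<theta> \<gamma> (ts_state (Suc t) \<omega>) (ts_control (Suc t) \<omega>) \<le> F (ts_state (Suc t) \<omega>)"
        using w A_aff[of "ts_state (Suc t) \<omega>" "ts_param (Suc t) \<omega>" \<gamma>] g ne
          affinity_le_1[OF \<theta> g good_adm[OF w, of "Suc t"]]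
        by (auto simp: F_def good_def)
    qed simp
    also have "\<dots> = (\<integral>\<^sup>+\<omega>. ennreal (sqrt_ratio M \<theta> \<gamma> t (hist t \<omega>))
        * (\<integral>\<^sup>+z. s \<gamma> (ts_state t \<omega>) (ts_control t \<omega>) z * F (snd z) \<partial>(\<Lambda> \<Otimes>\<^sub>M H)) \<partial>P)"
      unfolding s_def by (rule nn_integral_sqrt_ratio_Suc) measurable
    also have "\<dots> \<le> (\<integral>\<^sup>+\<omega>. ennreal \<rho> * ennreal (sqrt_ratio M \<theta> \<gamma> t (hist t \<omega>)) \<partial>P)"
    proof (rule nn_integral_mono_AE, use AE_good in eventually_elim)
      fix \<omega> assume "good \<omega>"
      from sF'[OF g good_adm[OF this, of t]]
      show "ennreal (sqrt_ratio M \<theta> \<gamma> t (hist t \<omega>))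
        * (\<integral>\<^sup>+z. s \<gamma> (ts_state t \<omega>) (ts_control t \<omega>) z * F (snd z) \<partial>(\<Lambda> \<Otimes>\<^sub>M H))
        \<le> ennreal \<rho> * ennreal (sqrt_ratio M \<theta> \<gamma> t (hist t \<omega>))"
        by (subst mult.commute) (rule mult_right_mono, simp_all)
    qed
    also have "\<dots> = ennreal \<rho> * (\<integral>\<^sup>+\<omega>. ennreal (sqrt_ratio M \<theta> \<gamma> t (hist t \<omega>)) \<partial>P)"
      by (rule nn_integral_cmult) measurable
    finally show ?thesis .
  qed
  moreover have "0 < \<rho>" "\<rho> < 1" using \<open>0 < e\<close> by (auto simp: \<rho>_def)
  ultimately show thesis using that by blast
qed

text \<open>A factor \<rho> per two steps is a rate \<open>sqrt \<rho>\<close> per step. The factor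
  \<open>1 / \<sigma>\<close> absorbs the parity: the induction starts at times 0 and 1, where the
  mean is at most 1.\<close>

lemma nn_integral_sqrt_ratio_bound:
  obtains \<sigma> :: real where "0 < \<sigma>" "\<sigma> < 1"
    "\<And>\<gamma> t. \<gamma> \<in> params M \<Longrightarrow> \<gamma> \<noteq> \<theta> \<Longrightarrow>
      (\<integral>\<^sup>+\<omega>. ennreal (sqrt_ratio M \<theta> \<gamma> t (hist t \<omega>)) \<partial>P) \<le> ennreal (\<sigma> ^ t / \<sigma>)"
proof -
  obtain \<rho> where \<rho>: "0 < \<rho>" "\<rho> < 1" and step: "\<And>\<gamma> t. \<gamma> \<in> params M \<Longrightarrow> \<gamma> \<noteq> \<theta> \<Longrightarrow>
      (\<integral>\<^sup>+\<omega>. ennreal (sqrt_ratio M \<theta> \<gamma> (Suc (Suc t)) (hist (Suc (Suc t)) \<omega>)) \<partial>P)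
        \<le> ennreal \<rho> * (\<integral>\<^sup>+\<omega>. ennreal (sqrt_ratio M \<theta> \<gamma> t (hist t \<omega>)) \<partial>P)"
    by (rule two_step_contraction) blast
  define \<sigma> where "\<sigma> = sqrt \<rho>"
  have \<sigma>: "0 < \<sigma>" "\<sigma> < 1" "\<rho> = \<sigma> * \<sigma>" using \<rho> by (auto simp: \<sigma>_def)
  have "(\<integral>\<^sup>+\<omega>. ennreal (sqrt_ratio M \<theta> \<gamma> t (hist t \<omega>)) \<partial>P) \<le> ennreal (\<sigma> ^ t / \<sigma>)"
    if g: "\<gamma> \<in> params M" "\<gamma> \<noteq> \<theta>" for \<gamma> t
  proof (induction t rule: induct_nat_012)
    case 0
    have "1 \<le> 1 / \<sigma>" using \<sigma> by simp
    then have "1 \<le> ennreal (1 / \<sigma>)" by (simp only: ennreal_1[symmetric] ennreal_leI)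
    then show ?case by (simp add: sqrt_ratio_def likelihood_0 emeasure_space_1)
  next
    case 1
    have "(\<integral>\<^sup>+\<omega>. ennreal (sqrt_ratio M \<theta> \<gamma> (Suc 0) (hist (Suc 0) \<omega>)) \<partial>P)
        = (\<integral>\<^sup>+\<omega>. affinity M \<theta> \<gamma> (ts_state 0 \<omega>) (ts_control 0 \<omega>) \<partial>P)"
      using nn_integral_sqrt_ratio_Suc[OF g(1), of "\<lambda>_. 1" 0]
      by (simp add: affinity_def sqrt_ratio_def likelihood_0)
    also have "\<dots> \<le> (\<integral>\<^sup>+\<omega>. 1 \<partial>P)"
      by (rule nn_integral_mono_AE, use AE_good in eventually_elim)
        (rule affinity_le_1[OF \<theta> g(1) good_adm])
    finally show ?case using \<sigma> by (simp add: emeasure_space_1)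
  next
    case (ge2 n)
    have "(\<integral>\<^sup>+\<omega>. ennreal (sqrt_ratio M \<theta> \<gamma> (Suc (Suc n)) (hist (Suc (Suc n)) \<omega>)) \<partial>P)
       \<le> ennreal \<rho> * (\<integral>\<^sup>+\<omega>. ennreal (sqrt_ratio M \<theta> \<gamma> n (hist n \<omega>)) \<partial>P)"
      by (rule step[OF g])
    also have "\<dots> \<le> ennreal \<rho> * ennreal (\<sigma> ^ n / \<sigma>)"
      by (rule mult_left_mono[OF ge2(1)]) simp
    also have "\<dots> = ennreal (\<sigma> ^ Suc (Suc n) / \<sigma>)"
      using \<sigma> by (subst ennreal_mult[symmetric]) (auto simp: mult.assoc)
    finally show ?case .
  qed
  with \<sigma> show thesis using that by blast
qed

section \<open>Concentration of the posterior\<close>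

lemma sum_likelihood_pos:
  assumes "good \<omega>"
  shows "0 < (\<Sum>\<gamma>\<in>params M. likelihood M \<gamma> t (hist t \<omega>) * p0 \<gamma>)"
  using finite_params \<theta> likelihood_pos[OF _ assms] p0_pos by (intro sum_pos) auto

lemma posterior_nonneg:
  assumes "good \<omega>" "\<gamma> \<in> params M"
  shows "0 \<le> posterior M p0 t (hist t \<omega>) \<gamma>"
  using sum_likelihood_pos[OF assms(1), of t] likelihood_pos[OF assms(2,1), of t] p0_pos[OF assms(2)]
  by (simp add: posterior_def)

lemma one_minus_posterior:
  assumes "good \<omega>"
  shows "1 - posterior M p0 t (hist t \<omega>) \<theta> = (\<Sum>\<gamma>\<in>params M - {\<theta>}. posterior M p0 t (hist t \<omega>) \<gamma>)"
proof -
  have "(\<Sum>\<gamma>\<in>params M. posterior M p0 t (hist t \<omega>) \<gamma>) = 1"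
    using sum_likelihood_pos[OF assms, of t] by (simp add: posterior_def sum_divide_distrib[symmetric])
  then show ?thesis using sum.remove[OF finite_params \<theta>, of "posterior M p0 t (hist t \<omega>)"] by simp
qed

text \<open>Of the normalising sum only the terms of \<gamma> and \<theta> are kept, and
  \<open>ratio_le_sqrt\<close> is applied to them.\<close>

lemma posterior_le_sqrt_ratio:
  assumes w: "good \<omega>" and g: "\<gamma> \<in> params M" "\<gamma> \<noteq> \<theta>"
  shows "posterior M p0 t (hist t \<omega>) \<gamma> \<le> sqrt (p0 \<gamma> / p0 \<theta>) * sqrt_ratio M \<theta> \<gamma> t (hist t \<omega>)"
proof -
  let ?l = "\<lambda>\<gamma>. likelihood M \<gamma> t (hist t \<omega>) * p0 \<gamma>"
  have pos: "0 < ?l \<gamma>" if "\<gamma> \<in> params M" for \<gamma>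
    using likelihood_pos[OF that w] p0_pos[OF that] by simp
  have "?l \<gamma> + ?l \<theta> = (\<Sum>\<gamma>\<in>{\<gamma>, \<theta>}. ?l \<gamma>)" using g by simp
  also have "\<dots> \<le> (\<Sum>\<gamma>\<in>params M. ?l \<gamma>)"
    using g \<theta> finite_params pos by (intro sum_mono2) (auto intro: less_imp_le)
  finally have "?l \<gamma> / (\<Sum>\<gamma>\<in>params M. ?l \<gamma>) \<le> sqrt (?l \<gamma> / ?l \<theta>)"
    by (rule ratio_le_sqrt[OF pos[OF g(1)] pos[OF \<theta>]])
  then show ?thesis
    by (simp add: posterior_def sqrt_ratio_def real_sqrt_mult real_sqrt_divide mult.commute)
qed

text \<open>The mass of the wrong parameters is summed over finitely many \<gamma>, each bounded in
  mean by a multiple of \<open>\<sigma> ^ t / \<sigma>\<close>. The rate is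
  \<open>b = - ln \<sigma>\<close>.\<close>

lemma posterior_concentration:
  obtains a b :: real where "0 < a" "0 < b"
    "\<And>t. (\<integral>\<omega>. 1 - posterior M p0 t (hist t \<omega>) \<theta> \<partial>P) \<le> a * exp (- b * real t)"
proof -
  obtain \<sigma> where \<sigma>: "0 < \<sigma>" "\<sigma> < 1" and bound: "\<And>\<gamma> t. \<gamma> \<in> params M \<Longrightarrow> \<gamma> \<noteq> \<theta> \<Longrightarrow>
      (\<integral>\<^sup>+\<omega>. ennreal (sqrt_ratio M \<theta> \<gamma> t (hist t \<omega>)) \<partial>P) \<le> ennreal (\<sigma> ^ t / \<sigma>)"
    by (rule nn_integral_sqrt_ratio_bound) blast
  define K where "K = (\<Sum>\<gamma>\<in>params M - {\<theta>}. sqrt (p0 \<gamma> / p0 \<theta>))"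
  have r0: "0 \<le> sqrt (p0 \<gamma> / p0 \<theta>)" if "\<gamma> \<in> params M" for \<gamma>
    using p0_pos[OF that] p0_pos[OF \<theta>] by simp
  have K0: "0 \<le> K" unfolding K_def using r0 by (intro sum_nonneg) auto
  have "(\<integral>\<omega>. 1 - posterior M p0 t (hist t \<omega>) \<theta> \<partial>P) \<le> (K + 1) / \<sigma> * exp (- (- ln \<sigma>) * real t)" for t
  proof -
    have "(\<integral>\<^sup>+\<omega>. ennreal (1 - posterior M p0 t (hist t \<omega>) \<theta>) \<partial>P)
      \<le> (\<integral>\<^sup>+\<omega>. (\<Sum>\<gamma>\<in>params M - {\<theta>}. ennreal (sqrt (p0 \<gamma> / p0 \<theta>)) * ennreal (sqrt_ratio M \<theta> \<gamma> t (hist t \<omega>))) \<partial>P)"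
    proof (rule nn_integral_mono_AE, use AE_good in eventually_elim)
      fix \<omega> assume w: "good \<omega>"
      have "ennreal (1 - posterior M p0 t (hist t \<omega>) \<theta>)
          = (\<Sum>\<gamma>\<in>params M - {\<theta>}. ennreal (posterior M p0 t (hist t \<omega>) \<gamma>))"
        unfolding one_minus_posterior[OF w] using posterior_nonneg[OF w] by (subst sum_ennreal) auto
      also have "\<dots> \<le> (\<Sum>\<gamma>\<in>params M - {\<theta>}. ennreal (sqrt (p0 \<gamma> / p0 \<theta>)) * ennreal (sqrt_ratio M \<theta> \<gamma> t (hist t \<omega>)))"
        using posterior_le_sqrt_ratio[OF w] r0
        by (intro sum_mono) (auto simp: ennreal_mult'[symmetric] intro!: ennreal_leI)
      finally show "ennreal (1 - posterior M p0 t (hist t \<omega>) \<theta>)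
        \<le> (\<Sum>\<gamma>\<in>params M - {\<theta>}. ennreal (sqrt (p0 \<gamma> / p0 \<theta>)) * ennreal (sqrt_ratio M \<theta> \<gamma> t (hist t \<omega>)))" .
    qed
    also have "\<dots> = (\<Sum>\<gamma>\<in>params M - {\<theta>}. \<integral>\<^sup>+\<omega>. ennreal (sqrt (p0 \<gamma> / p0 \<theta>)) * ennreal (sqrt_ratio M \<theta> \<gamma> t (hist t \<omega>)) \<partial>P)"
      by (rule nn_integral_sum) measurable
    also have "\<dots> = (\<Sum>\<gamma>\<in>params M - {\<theta>}. ennreal (sqrt (p0 \<gamma> / p0 \<theta>)) * (\<integral>\<^sup>+\<omega>. ennreal (sqrt_ratio M \<theta> \<gamma> t (hist t \<omega>)) \<partial>P))"
      by (intro sum.cong refl nn_integral_cmult) measurable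
    also have "\<dots> \<le> (\<Sum>\<gamma>\<in>params M - {\<theta>}. ennreal (sqrt (p0 \<gamma> / p0 \<theta>)) * ennreal (\<sigma> ^ t / \<sigma>))"
      by (intro sum_mono mult_left_mono bound) auto
    also have "\<dots> = ennreal (K * (\<sigma> ^ t / \<sigma>))"
      unfolding K_def sum_distrib_right using r0 \<sigma>
      by (subst sum_ennreal[symmetric]) (auto simp flip: ennreal_mult'')
    finally have "(\<integral>\<omega>. 1 - posterior M p0 t (hist t \<omega>) \<theta> \<partial>P) \<le> K * (\<sigma> ^ t / \<sigma>)"
      using K0 \<sigma> by (intro integral_real_bounded) auto
    \<comment> \<open>\<open>K\<close> is 0 when \<theta> is the only parameter; enlarging it to
      \<open>K + 1\<close> makes the constant \<open>a\<close> strictly positive.\<close>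
    also have "\<dots> \<le> (K + 1) * (\<sigma> ^ t / \<sigma>)"
      using \<sigma> by (intro mult_right_mono) auto
    also have "exp (- (- ln \<sigma>) * real t) = \<sigma> ^ t"
      using \<sigma> exp_of_nat_mult[of t "ln \<sigma>"] by (simp add: mult.commute)
    then have "(K + 1) * (\<sigma> ^ t / \<sigma>) = (K + 1) / \<sigma> * exp (- (- ln \<sigma>) * real t)"
      by simp
    finally show ?thesis .
  qed
  moreover have "0 < (K + 1) / \<sigma>" "0 < - ln \<sigma>" using K0 \<sigma> by auto
  ultimately show thesis using that by blast
qed

text \<open>Given the history, the sampled parameter is distributed by the posterior, so the
  conditional probability of a wrong one is the posterior mass outside \<theta>. This links
  concentration to the regret.\<close>

lemma prob_wrong_param:
  "prob {\<omega> \<in> space P. ts_param t \<omega> \<noteq> \<theta>} = (\<integral>\<omega>. 1 - posterior M p0 t (hist t \<omega>) \<theta> \<partial>P)"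
proof -
  have m [measurable]: "(\<lambda>\<omega>. posterior M p0 t (hist t \<omega>) \<theta>) \<in> borel_measurable P"
  proof -
    have "(\<lambda>\<omega>. likelihood M \<gamma> t (hist t \<omega>)) \<in> borel_measurable P" if "\<gamma> \<in> params M" for \<gamma>
      by (rule measurable_compose[OF measurable_hist measurable_likelihood[OF that]])
    with \<theta> show ?thesis
      unfolding posterior_def by (intro borel_measurable_divide borel_measurable_sum borel_measurable_times) auto
  qed
  \<comment> \<open>Adding the trivial condition on the history gives the event the rectangular form
    used by \<open>cond_law\<close>.\<close>
  have "emeasure P {\<omega> \<in> space P. ts_param t \<omega> \<noteq> \<theta>}
      = emeasure P {\<omega> \<in> space P. hist t \<omega> \<in> space (HS t) \<and> ts_param t \<omega> \<in> params M - {\<theta>}}"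
    using in_space(2)[of _ t] measurable_space[OF measurable_hist, of _ t]
    by (intro arg_cong[where f = "emeasure P"]) blast
  also have "\<dots> = (\<integral>\<^sup>+\<omega>. indicator (space (HS t)) (hist t \<omega>)
      * emeasure (point_measure (params M) (\<lambda>\<gamma>. ennreal (posterior M p0 t (hist t \<omega>) \<gamma>))) (params M - {\<theta>}) \<partial>P)"
  proof -
    have "cond_law P (hist t) (HS t) (ts_param t) Pa
       (\<lambda>h. point_measure (params M) (\<lambda>\<gamma>. ennreal (posterior M p0 t h \<gamma>)))"
      using law by (auto simp: thompson_law_def Let_def)
    then show ?thesis unfolding cond_law_def by (auto simp del: Diff_iff)
  qed
  also have "\<dots> = (\<integral>\<^sup>+\<omega>. ennreal (1 - posterior M p0 t (hist t \<omega>) \<theta>) \<partial>P)"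
  proof (rule nn_integral_cong_AE, use AE_good AE_space in eventually_elim)
    fix \<omega> assume w: "good \<omega>" and "\<omega> \<in> space P"
    then have "hist t \<omega> \<in> space (HS t)" by (auto intro: measurable_space[OF measurable_hist])
    then show "indicator (space (HS t)) (hist t \<omega>)
      * emeasure (point_measure (params M) (\<lambda>\<gamma>. ennreal (posterior M p0 t (hist t \<omega>) \<gamma>))) (params M - {\<theta>})
      = ennreal (1 - posterior M p0 t (hist t \<omega>) \<theta>)"
      using finite_params posterior_nonneg[OF w]
      by (subst one_minus_posterior[OF w], subst sum_ennreal[symmetric])
        (auto simp: emeasure_point_measure_finite)
  qed
  finally have "emeasure P {\<omega> \<in> space P. ts_param t \<omega> \<noteq> \<theta>}
     = (\<integral>\<^sup>+\<omega>. ennreal (1 - posterior M p0 t (hist t \<omega>) \<theta>) \<partial>P)" .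
  moreover have "AE \<omega> in P. 0 \<le> 1 - posterior M p0 t (hist t \<omega>) \<theta>"
    using AE_good
  proof eventually_elim
    fix \<omega> assume w: "good \<omega>"
    show "0 \<le> 1 - posterior M p0 t (hist t \<omega>) \<theta>"
      unfolding one_minus_posterior[OF w] using posterior_nonneg[OF w] by (intro sum_nonneg) auto
  qed
  ultimately show ?thesis
    by (subst integral_eq_nn_integral) (auto simp: measure_def)
qed

section \<open>Expected rewards, values and the residual regret\<close>

lemma ex_reward_bound: "\<exists>K. \<forall>r\<in>rewards M. \<bar>r\<bar> \<le> K"
  using compact_imp_bounded[OF compact_rewards] by (auto simp: bounded_iff)

lemma expectation_reward:
  shows "integrable P (\<lambda>\<omega>. ts_reward t \<omega>)"
    and "integrable P (\<lambda>\<omega>. \<integral>r. r \<partial>reward_law M \<theta> (ts_state t \<omega>) (ts_control t \<omega>))"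
    and "(\<integral>\<omega>. ts_reward t \<omega> \<partial>P) = (\<integral>\<omega>. (\<integral>r. r \<partial>reward_law M \<theta> (ts_state t \<omega>) (ts_control t \<omega>)) \<partial>P)"
proof -
  obtain K where K: "\<And>r. r \<in> rewards M \<Longrightarrow> \<bar>r\<bar> \<le> K" using ex_reward_bound by blast
  have norm: "AE \<omega> in P. (\<integral>\<^sup>+r. ennreal (rew_dens M \<theta> (ts_state t \<omega>) (ts_control t \<omega>) r) \<partial>\<Lambda>) = 1"
    using AE_good by eventually_elim (rule nn_integral_dens(1)[OF \<theta> good_adm])
  have [measurable]: "(\<lambda>r. r) \<in> borel_measurable RS"
    by (simp add: reward_space_def measurable_restrict_space1)
  note * = cond_law_density_integral[where P = P and \<eta> = \<Lambda>
        and Z = "\<lambda>\<omega>. (hist t \<omega>, ts_param t \<omega>, ts_control t \<omega>)"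
        and S = "HS t \<Otimes>\<^sub>M (Pa \<Otimes>\<^sub>M CS)"
        and Y = "ts_reward t" and T = RS
        and k = "\<lambda>p. rew_dens M \<theta> (snd (fst (fst p))) (snd (snd (fst p))) (snd p)"
        and g = "\<lambda>r. r" and B = K,
        OF prob_space_P _ _ rew.sigma_finite_measure_axioms sets_rew_ref]
  show "integrable P (\<lambda>\<omega>. ts_reward t \<omega>)"
    using *(1) cond_law_reward[of t] norm K by simp
  show "integrable P (\<lambda>\<omega>. \<integral>r. r \<partial>reward_law M \<theta> (ts_state t \<omega>) (ts_control t \<omega>))"
    using *(2) cond_law_reward[of t] norm K by (simp add: reward_law_def)
  show "(\<integral>\<omega>. ts_reward t \<omega> \<partial>P) = (\<integral>\<omega>. (\<integral>r. r \<partial>reward_law M \<theta> (ts_state t \<omega>) (ts_control t \<omega>)) \<partial>P)"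
    using *(3) cond_law_reward[of t] norm K by (simp add: reward_law_def)
qed

lemma expectation_next_state:
  fixes v :: "'x \<Rightarrow> real"
  assumes "v \<in> borel_measurable SS" "\<And>y. y \<in> states M \<Longrightarrow> \<bar>v y\<bar> \<le> B"
  shows "integrable P (\<lambda>\<omega>. \<integral>y. v y \<partial>trans_law M \<theta> (ts_state t \<omega>) (ts_control t \<omega>))"
    and "(\<integral>\<omega>. v (ts_state (Suc t) \<omega>) \<partial>P)
       = (\<integral>\<omega>. (\<integral>y. v y \<partial>trans_law M \<theta> (ts_state t \<omega>) (ts_control t \<omega>)) \<partial>P)"
proof -
  have norm: "AE \<omega> in P. (\<integral>\<^sup>+y. ennreal (trans_dens M \<theta> (ts_state t \<omega>) (ts_control t \<omega>) y) \<partial>H) = 1"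
    using AE_good by eventually_elim (rule nn_integral_dens(2)[OF \<theta> good_adm])
  note * = cond_law_density_integral[where P = P and \<eta> = H
        and Z = "\<lambda>\<omega>. (hist t \<omega>, ts_param t \<omega>, ts_control t \<omega>, ts_reward t \<omega>)"
        and S = "HS t \<Otimes>\<^sub>M (Pa \<Otimes>\<^sub>M (CS \<Otimes>\<^sub>M RS))"
        and Y = "ts_state (Suc t)" and T = SS
        and k = "\<lambda>p. trans_dens M \<theta> (snd (fst (fst p))) (fst (snd (snd (fst p)))) (snd p)"
        and g = v and B = B,
        OF prob_space_P _ _ st.sigma_finite_measure_axioms sets_state_ref]
  show "integrable P (\<lambda>\<omega>. \<integral>y. v y \<partial>trans_law M \<theta> (ts_state t \<omega>) (ts_control t \<omega>))"
    using *(2) cond_law_trans[of t] norm assms by (simp add: trans_law_def)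
  show "(\<integral>\<omega>. v (ts_state (Suc t) \<omega>) \<partial>P)
       = (\<integral>\<omega>. (\<integral>y. v y \<partial>trans_law M \<theta> (ts_state t \<omega>) (ts_control t \<omega>)) \<partial>P)"
    using *(3) cond_law_trans[of t] norm assms by (simp add: trans_law_def)
qed

text \<open>Rewards lie in a compact set, so the discounted series is dominated by a geometric one
  and expectation and sum may be interchanged.\<close>

lemma ts_value_sums:
  "(\<lambda>k. disc M ^ k * (\<integral>\<omega>. ts_reward (n + k) \<omega> \<partial>P)) sums ts_value M P n"
proof -
  obtain K where K: "\<And>r. r \<in> rewards M \<Longrightarrow> \<bar>r\<bar> \<le> K" using ex_reward_bound by blast
  have le: "norm (disc M ^ k * ts_reward (n + k) \<omega>) \<le> disc M ^ k * K" if "\<omega> \<in> space P" for k \<omega>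
    using K[OF in_space(3)[OF that]] disc_nonneg by (auto simp: abs_mult intro!: mult_left_mono)
  have summ: "summable (\<lambda>k. disc M ^ k * K)"
    using disc_nonneg disc_less_1 by (intro summable_mult2 summable_geometric) auto
  have "(\<lambda>k. \<integral>\<omega>. disc M ^ k * ts_reward (n + k) \<omega> \<partial>P) sums (\<integral>\<omega>. (\<Sum>k. disc M ^ k * ts_reward (n + k) \<omega>) \<partial>P)"
  proof (rule sums_integral)
    show "integrable P (\<lambda>\<omega>. disc M ^ k * ts_reward (n + k) \<omega>)" for k
      by (intro integrable_mult_right expectation_reward)
    show "AE \<omega> in P. summable (\<lambda>k. norm (disc M ^ k * ts_reward (n + k) \<omega>))"
      by (intro AE_I2 summable_comparison_test'[OF summ]) (use le in auto)
    have "norm (\<integral>\<omega>. norm (disc M ^ k * ts_reward (n + k) \<omega>) \<partial>P) \<le> disc M ^ k * K" for k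
      unfolding real_norm_def[of "lebesgue_integral _ _"]
      by (rule abs_integral_le_prob[OF prob_space_P])
        (use le expectation_reward(1) in \<open>auto intro!: borel_measurable_integrable\<close>)
    then show "summable (\<lambda>k. \<integral>\<omega>. norm (disc M ^ k * ts_reward (n + k) \<omega>) \<partial>P)"
      by (intro summable_comparison_test'[OF summ]) auto
  qed
  then show ?thesis by (simp add: ts_value_def)
qed

text \<open>The loss of step \<open>t\<close> is the Bellman defect of the chosen control, nonzero
  only if a wrong parameter was sampled. One factor \<open>1 / (1 - disc M)\<close> comes from the
  bound on \<open>v\<close>, the other from summing the discounted losses.\<close>

lemma residual_regret_bound:
  assumes v [measurable]: "v \<in> borel_measurable SS" and bv: "bounded (v ` states M)"
    and fp: "\<And>x. x \<in> states M \<Longrightarrow> v x = bellman_rhs M \<theta> v x (\<mu> \<theta> x)"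
    and C: "\<And>x u. (x, u) \<in> adm_pairs M \<Longrightarrow> \<bar>exp_reward M \<theta> x u\<bar> \<le> C" and C0: "0 \<le> C"
    and a: "0 \<le> a" and b: "0 \<le> b"
    and conc: "\<And>t. (\<integral>\<omega>. 1 - posterior M p0 t (hist t \<omega>) \<theta> \<partial>P) \<le> a * exp (- b * real t)"
  shows "residual_regret M v P n \<le> 2 * C * a * exp (- b * real n) / (1 - disc M)\<^sup>2"
proof -
  define B where "B = C / (1 - disc M)"
  have B0: "0 \<le> B" using C0 disc_less_1 by (simp add: B_def)
  have bounds: "x \<in> states M \<Longrightarrow> \<bar>v x\<bar> \<le> B"
    "(x, u) \<in> adm_pairs M \<Longrightarrow> \<bar>bellman_rhs M \<theta> v x u\<bar> \<le> B" for x u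
    unfolding B_def by (rule bellman_fixpoint_bound[OF \<theta> v bv \<mu>_adm[OF \<theta>] fp C]; assumption)+
  let ?v = "\<lambda>t \<omega>. v (ts_state t \<omega>)" and ?x = "ts_state" and ?u = "ts_control"
  have iv: "integrable P (?v t)" for t
    by (rule integrable_const_bound[of _ B]) (use bounds(1) in_space in \<open>auto intro!: AE_I2\<close>)
  have step: "(\<integral>\<omega>. ?v t \<omega> \<partial>P) - (\<integral>\<omega>. ts_reward t \<omega> \<partial>P) - disc M * (\<integral>\<omega>. ?v (Suc t) \<omega> \<partial>P)
      \<le> 2 * B * a * exp (- b * real t)" for t
  proof -
    let ?D = "\<lambda>\<omega>. ?v t \<omega> - (\<integral>r. r \<partial>reward_law M \<theta> (?x t \<omega>) (?u t \<omega>))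
      - disc M * (\<integral>y. v y \<partial>trans_law M \<theta> (?x t \<omega>) (?u t \<omega>))"
    let ?W = "{\<omega> \<in> space P. ts_param t \<omega> \<noteq> \<theta>}"
    note next_state = expectation_next_state[OF v bounds(1)]
    have W: "?W \<in> events"
    proof -
      have "?W = ts_param t -` (params M - {\<theta>}) \<inter> space P" using in_space(2) by auto
      moreover have "\<dots> \<in> events" by (rule measurable_sets[OF measurable_ts_param]) simp
      ultimately show ?thesis by simp
    qed
    \<comment> \<open>Reward and next value are replaced by their conditional means, which makes the
      integrand the Bellman defect \<open>?D\<close>.\<close>
    have "(\<integral>\<omega>. ?v t \<omega> \<partial>P) - (\<integral>\<omega>. ts_reward t \<omega> \<partial>P) - disc M * (\<integral>\<omega>. ?v (Suc t) \<omega> \<partial>P) = (\<integral>\<omega>. ?D \<omega> \<partial>P)"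
      using iv[of t] expectation_reward[of t] next_state[of t] by simp
    also have "\<dots> \<le> (\<integral>\<omega>. 2 * B * indicator ?W \<omega> \<partial>P)"
    proof (rule integral_mono_AE)
      show "integrable P ?D"
        using iv[of t] expectation_reward(2)[of t] next_state(1)[of t] by simp
      show "integrable P (\<lambda>\<omega>. 2 * B * indicator ?W \<omega>)"
        using W by (intro integrable_mult_right integrable_real_indicator) (auto simp: less_top[symmetric])
      show "AE \<omega> in P. ?D \<omega> \<le> 2 * B * indicator ?W \<omega>"
        using AE_good AE_space
      proof eventually_elim
        fix \<omega> assume w: "good \<omega>" and sp: "\<omega> \<in> space P"
        have adm: "(?x t \<omega>, ?u t \<omega>) \<in> adm_pairs M" by (rule good_adm[OF w])
        have D: "?D \<omega> = v (?x t \<omega>) - bellman_rhs M \<theta> v (?x t \<omega>) (?u t \<omega>)"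
          using exp_reward_eq[OF \<theta> adm] by (simp add: bellman_rhs_def)
        have x: "?x t \<omega> \<in> states M" using sp by (rule in_space)
        show "?D \<omega> \<le> 2 * B * indicator ?W \<omega>"
        \<comment> \<open>With the true parameter the control attains the optimality equation and
          the defect is 0; otherwise both terms of the defect are at most \<open>B\<close> in
          absolute value.\<close>
        proof (cases "ts_param t \<omega> = \<theta>")
          case True
          then have "?D \<omega> = 0" unfolding D using w fp[OF x] by (simp add: good_def)
          then show ?thesis using B0 by simp
        next
          case False
          then have "indicator ?W \<omega> = (1::real)" using sp by simp
          then show ?thesis unfolding D using bounds(1)[OF x] bounds(2)[OF adm] by simp
        qed
      qed
    qed
    also have "\<dots> = 2 * B * prob ?W" using W by simp
    also have "\<dots> \<le> 2 * B * (a * exp (- b * real t))"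
      unfolding prob_wrong_param using B0 by (intro mult_left_mono conc) auto
    finally show ?thesis by (simp add: mult.assoc)
  qed
  have vb: "\<bar>\<integral>\<omega>. ?v t \<omega> \<partial>P\<bar> \<le> B" for t
    by (rule abs_integral_le_prob[OF prob_space_P]) (use bounds(1) in_space in auto)
  have "(\<integral>\<omega>. ?v n \<omega> \<partial>P) - ts_value M P n \<le> 2 * B * a * exp (- b * real n) / (1 - disc M)"
    by (rule discounted_telescope_bound[where e = "\<lambda>t. \<integral>\<omega>. ?v t \<omega> \<partial>P",
          OF disc_nonneg disc_less_1 _ b step vb ts_value_sums])
      (use B0 a in simp)
  then show ?thesis
    by (simp add: residual_regret_def B_def power2_eq_square)
qed

end

section \<open>From the infima over admissible pairs to the regret bound\<close>

theorem proposition5p5: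
  fixes M :: "('x::polish_space, 'u::polish_space, 'p) model"
    and \<theta> :: 'p
    and \<nu> :: "'p \<Rightarrow> 'x \<Rightarrow> real"
    and \<mu> :: "'p \<Rightarrow> 'x \<Rightarrow> 'u"
    and prior :: "'x \<Rightarrow> 'p \<Rightarrow> real"
    and P :: "'x \<Rightarrow> (nat \<Rightarrow> ('x, 'u, 'p) ts_step) measure"
    and C :: real
  assumes "valid_model M" and "\<theta> \<in> params M"
    and "optimality_assumption M \<nu> \<mu>"
    and "\<And>x0 \<gamma>. x0 \<in> states M \<Longrightarrow> \<gamma> \<in> params M \<Longrightarrow> 0 < prior x0 \<gamma>"
    and "\<And>x0. x0 \<in> states M \<Longrightarrow> (\<Sum>\<gamma>\<in>params M. prior x0 \<gamma>) = 1"
    and "\<And>x0. x0 \<in> states M \<Longrightarrow> thompson_law M \<mu> (prior x0) \<theta> x0 (P x0)"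
    and "\<And>\<gamma>. \<gamma> \<in> params M \<Longrightarrow>
           0 < (INF ((x, u), r)\<in>adm_pairs M \<times> rewards M. rew_dens M \<gamma> x u r)"
    and "\<And>\<gamma>. \<gamma> \<in> params M \<Longrightarrow>
           0 < (INF ((x, u), y)\<in>adm_pairs M \<times> states M. trans_dens M \<gamma> x u y)"
    and "\<And>\<gamma>. \<gamma> \<in> params M \<Longrightarrow> \<gamma> \<noteq> \<theta> \<Longrightarrow>
           0 < (INF (x, u)\<in>adm_pairs M. rel_entropy (joint_law M \<theta> x u) (joint_law M \<gamma> x u))"
    and "0 \<le> C" and "\<And>x u. (x, u) \<in> adm_pairs M \<Longrightarrow> \<bar>exp_reward M \<theta> x u\<bar> \<le> C"
  shows "\<forall>x0\<in>states M. \<exists>a>0. \<exists>b>0.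
           (\<forall>t. (\<integral>\<omega>. 1 - posterior M (prior x0) t (hist t \<omega>) \<theta> \<partial>P x0) \<le> a * exp (- b * real t)) \<and>
           (\<forall>n. residual_regret M (\<nu> \<theta>) (P x0) n
                \<le> 2 * C * (1 + disc M) * a * exp (- b * real n) / (1 - disc M)\<^sup>2)"
proof
  fix x0 assume x0: "x0 \<in> states M"
  interpret controlled_model M by unfold_locales fact
  have opt: "bellman_solution M \<gamma> (\<nu> \<gamma>)" "\<mu> \<gamma> \<in> state_space M \<rightarrow>\<^sub>M control_space M"
    "\<And>x. x \<in> states M \<Longrightarrow> \<mu> \<gamma> x \<in> adm M x \<and> \<nu> \<gamma> x = bellman_rhs M \<gamma> (\<nu> \<gamma>) x (\<mu> \<gamma> x)"
    if "\<gamma> \<in> params M" for \<gamma>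
    using assms(3) that unfolding optimality_assumption_def by blast+
  define F where "F \<gamma> = (INF ((x, u), r)\<in>adm_pairs M \<times> rewards M. rew_dens M \<gamma> x u r)" for \<gamma>
  define Q where "Q \<gamma> = (INF ((x, u), y)\<in>adm_pairs M \<times> states M. trans_dens M \<gamma> x u y)" for \<gamma>
  \<comment> \<open>Finitely many parameters, among them \<theta>, so the least of the positive
    infima exists and is positive.\<close>
  define c where "c = Min (F ` params M \<union> Q ` params M)"
  have fin: "finite (F ` params M \<union> Q ` params M)" "F ` params M \<union> Q ` params M \<noteq> {}"
    using finite_params assms(2) by auto
  have "0 < c"
    unfolding c_def using assms(7,8) by (subst Min_gr_iff[OF fin]) (auto simp: F_def Q_def)
  have cF: "c \<le> F \<gamma>" and cQ: "c \<le> Q \<gamma>" if "\<gamma> \<in> params M" for \<gamma>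
    unfolding c_def using fin that by auto
  \<comment> \<open>A real infimum lies below the values only if these are bounded below;
    nonnegativity of the densities provides this.\<close>
  have F_le: "F \<gamma> \<le> rew_dens M \<gamma> x u r"
    if g: "\<gamma> \<in> params M" "(x, u) \<in> adm_pairs M" "r \<in> rewards M" for \<gamma> x u r
  proof -
    have "bdd_below ((\<lambda>((x, u), r). rew_dens M \<gamma> x u r) ` (adm_pairs M \<times> rewards M))"
      using dens_nonneg(1)[OF g(1)] by (intro bdd_belowI[of _ 0]) auto
    from cINF_lower[OF this, of "((x, u), r)"] show ?thesis using g by (simp add: F_def)
  qed
  have Q_le: "Q \<gamma> \<le> trans_dens M \<gamma> x u y"
    if g: "\<gamma> \<in> params M" "(x, u) \<in> adm_pairs M" "y \<in> states M" for \<gamma> x u y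
  proof -
    have "bdd_below ((\<lambda>((x, u), y). trans_dens M \<gamma> x u y) ` (adm_pairs M \<times> states M))"
      using dens_nonneg(2)[OF g(1)] by (intro bdd_belowI[of _ 0]) auto
    from cINF_lower[OF this, of "((x, u), y)"] show ?thesis using g by (simp add: Q_def)
  qed
  have sep: "0 < rel_entropy (joint_law M \<theta> x u) (joint_law M \<gamma> x u)"
    if "\<gamma> \<in> params M" "\<gamma> \<noteq> \<theta>" "(x, u) \<in> adm_pairs M" for \<gamma> x u
  proof -
    have "(INF (x, u)\<in>adm_pairs M. rel_entropy (joint_law M \<theta> x u) (joint_law M \<gamma> x u))
       \<le> rel_entropy (joint_law M \<theta> x u) (joint_law M \<gamma> x u)"
      using INF_lower[OF that(3), of "\<lambda>(x, u). rel_entropy (joint_law M \<theta> x u) (joint_law M \<gamma> x u)"] by simp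
    then show ?thesis by (rule less_le_trans[OF assms(9)[OF that(1,2)]])
  qed
  interpret thompson M \<mu> \<theta> "prior x0" x0 "P x0" c
  proof unfold_locales
    show "\<theta> \<in> params M" "x0 \<in> states M" "0 < c" by fact+
    show "thompson_law M \<mu> (prior x0) \<theta> x0 (P x0)" by (rule assms(6)[OF x0])
    show "0 < prior x0 \<gamma>" if "\<gamma> \<in> params M" for \<gamma> by (rule assms(4)[OF x0 that])
    show "\<mu> \<gamma> \<in> state_space M \<rightarrow>\<^sub>M control_space M" if "\<gamma> \<in> params M" for \<gamma> by (rule opt(2)[OF that])
    show "\<mu> \<gamma> x \<in> adm M x" if "\<gamma> \<in> params M" "x \<in> states M" for \<gamma> x using opt(3)[OF that] by simp
    show "c \<le> rew_dens M \<gamma> x u r" if "\<gamma> \<in> params M" "(x, u) \<in> adm_pairs M" "r \<in> rewards M" for \<gamma> x u r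
      using cF[OF that(1)] F_le[OF that] by simp
    show "c \<le> trans_dens M \<gamma> x u y" if "\<gamma> \<in> params M" "(x, u) \<in> adm_pairs M" "y \<in> states M" for \<gamma> x u y
      using cQ[OF that(1)] Q_le[OF that] by simp
    show "0 < rel_entropy (joint_law M \<theta> x u) (joint_law M \<gamma> x u)"
      if "\<gamma> \<in> params M" "\<gamma> \<noteq> \<theta>" "(x, u) \<in> adm_pairs M" for \<gamma> x u
      by (rule sep[OF that])
  qed
  obtain a b where ab: "0 < a" "0 < b"
    and conc: "\<And>t. (\<integral>\<omega>. 1 - posterior M (prior x0) t (hist t \<omega>) \<theta> \<partial>P x0) \<le> a * exp (- b * real t)"
    by (rule posterior_concentration) blast
  have "residual_regret M (\<nu> \<theta>) (P x0) n
     \<le> 2 * C * (1 + disc M) * a * exp (- b * real n) / (1 - disc M)\<^sup>2" for n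
  proof -
    have "residual_regret M (\<nu> \<theta>) (P x0) n \<le> 2 * C * a * exp (- b * real n) / (1 - disc M)\<^sup>2"
      using opt(1,3)[OF assms(2)] assms(10,11) ab conc
      by (intro residual_regret_bound) (auto simp: bellman_solution_def)
    \<comment> \<open>A factor 1 is inserted and then enlarged to \<open>1 + disc M\<close> to reach
      the stated constant.\<close>
    also have "\<dots> = 2 * C * 1 * a * exp (- b * real n) / (1 - disc M)\<^sup>2" by simp
    also have "\<dots> \<le> 2 * C * (1 + disc M) * a * exp (- b * real n) / (1 - disc M)\<^sup>2"
      using assms(10) ab disc_nonneg by (intro divide_right_mono mult_right_mono mult_left_mono) auto
    finally show ?thesis .
  qed
  with ab conc show "\<exists>a>0. \<exists>b>0.
           (\<forall>t. (\<integral>\<omega>. 1 - posterior M (prior x0) t (hist t \<omega>) \<theta> \<partial>P x0) \<le> a * exp (- b * real t)) \<and>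
           (\<forall>n. residual_regret M (\<nu> \<theta>) (P x0) n
                \<le> 2 * C * (1 + disc M) * a * exp (- b * real n) / (1 - disc M)\<^sup>2)"
    by blast
qed

end
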